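(* Let $t\ge 3$ be an integer. Consider one trinomial and one $t$-nomial in two positive variables $x=(x_1,x_2)\in\mathbb{R}^2_{>}$, $$\bar c_1\,x^{\bar b^1}+\bar c_2\,x^{\bar b^2}-1=0,\qquad \varepsilon_1c_1\,x^{b^1}+\dots+\varepsilon_{t-1}c_{t-1}\,x^{b^{t-1}}-1=0,$$ with real exponent vectors $\bar b^1,\bar b^2,b^1,\dots,b^{t-1}\in\mathbb{R}^2$, all nonzero, with $\bar b^1\ne\bar b^2$ and $b^i\ne b^j$ for $i\ne j$, with coefficients $\bar c_1,\bar c_2,c_1,\dots,c_{t-1}>0$ and arbitrary signs $\varepsilon_1,\dots,\varepsilon_{t-1}\in\{+1,-1\}$, and such that the matrix $(\bar b^1,\bar b^2,b^1,\dots,b^{t-1})\in\mathbb{R}^{2\times(t+1)}$ has rank two. Then the number of positive solutions $x\in\mathbb{R}^2_{>}$ of this system is infinite or bounded above by $$\frac13t^3-t^2+\frac83t-2.$$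
   Context: $\mathbb{R}_{>}$ denotes the positive reals. For $x\in\mathbb{R}^2_{>}$ and $b=(\beta_1,\beta_2)\in\mathbb{R}^2$, the generalized monomial is $x^b=x_1^{\beta_1}x_2^{\beta_2}$ (real exponents). *)

theory Defs
  imports "HOL-Analysis.Analysis"
begin

definition positive_orthant :: "(real ^ 2) set" where
  "positive_orthant = {x. x $ 1 > 0 \<and> x $ 2 > 0}"

definition monomial :: "real ^ 2 \<Rightarrow> real ^ 2 \<Rightarrow> real" where
  "monomial x b = (x $ 1) powr (b $ 1) * (x $ 2) powr (b $ 2)"

end

theory Submission
  imports Defs "Jordan_Normal_Form.Determinant"
begin

text \<open>
  If the two exponents of the trinomial are linearly independent, then its zero set is
  parametrised by the value \<open>u\<close> of its first term, its second term being \<open>1 - u\<close>. The \<open>t\<close>-nomial turns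
  into a function \<open>f(u) = \<Sum>\<^sub>i a\<^sub>i u\<^sup>\<alpha> (1 - u)\<^sup>\<beta>\<close> on \<open>(0, 1)\<close> with \<open>t\<close> terms, where \<open>\<alpha>, \<beta>\<close>
  depend on \<open>i\<close> and one term is constant. Its zeros are counted by the method of Voorhoeve and van der Poorten. Let
  \<open>f\<^sub>1, \<dots>, f\<^sub>k\<close> be some of the terms, \<open>W\<^sub>j\<close> the Wronskian of the first \<open>j\<close> of them and
  \<open>L\<^sub>k\<close> the Wronskian of all of them and \<open>f\<close>. The quotient rule and a determinant identity give
  \<open>(L\<^sub>k\<^sub>-\<^sub>1 / W\<^sub>k)' = W\<^sub>k\<^sub>-\<^sub>1 L\<^sub>k / W\<^sub>k\<^sup>2\<close> (\<open>wronskian_identity\<close>), so a Rolle argument bounds the zeros of \<open>L\<^sub>k\<^sub>-\<^sub>1\<close> by those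
  of \<open>L\<^sub>k\<close>, of \<open>W\<^sub>k\<close> and of \<open>W\<^sub>k\<^sub>-\<^sub>1\<close>, plus one. This is effective because \<open>W\<^sub>j\<close> is the product of a positive
  function and a polynomial of degree at most \<open>j (j - 1) / 2\<close> (\<open>degree_wronskian\<close>). One starts from
  \<open>L\<^sub>1\<close>, a positive multiple of \<open>f'\<close> if \<open>f\<^sub>1 = 1\<close>, and stops when all extensions of the list have
  Wronskian zero or when only one term of \<open>f\<close> is left. The sum of all contributions is the stated cubic.

  The argument is carried out with sign changes in place of zeros. The crucial estimate is
  \<open>sign_changes_le_quotient\<close>: dividing by a polynomial \<open>p\<close> and differentiating loses at most
  \<open>1 + degree p\<close> sign changes, where a naive count would charge two for a root of \<open>p\<close>, one for the change
  of sign of \<open>p\<close> and one for the pole. Only in the first step are zeros converted into sign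
  changes of the derivative (\<open>card_zeros_le_sign_changes_deriv\<close>).

  If the exponents of the trinomial are parallel, then the trinomial fixes the value of one monomial up to two
  choices, and each choice leaves a one-variable exponential sum with \<open>t\<close> terms, which has at most \<open>t - 1\<close>
  zeros unless it vanishes identically and there are infinitely many solutions. The resulting bound
  \<open>2 (t - 1)\<close> is below the cubic one.
\<close>

section \<open>Sign changes of real functions\<close>

definition alternating :: "(real \<Rightarrow> real) \<Rightarrow> real list \<Rightarrow> bool" where
  "alternating F = successively (\<lambda>x y. x < y \<and> F x * F y < 0)"

text \<open>An alternating list with \<open>n + 1\<close> entries witnesses \<open>n\<close> sign changes. Sign changes, rather than zeros
with multiplicity, are counted because they make sense for arbitrary functions: products, quotients
and identically vanishing functions then cause no case distinctions.\<close>

definition sign_changes_le :: "real set \<Rightarrow> (real \<Rightarrow> real) \<Rightarrow> nat \<Rightarrow> bool" where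
  "sign_changes_le D F n \<longleftrightarrow> (\<forall>xs. set xs \<subseteq> D \<longrightarrow> alternating F xs \<longrightarrow> length xs \<le> Suc n)"

lemma alternating_Nil [simp]: "alternating F []"
  and alternating_single [simp]: "alternating F [x]"
  and alternating_Cons_Cons [simp]:
    "alternating F (x # y # xs) \<longleftrightarrow> x < y \<and> F x * F y < 0 \<and> alternating F (y # xs)"
  by (auto simp: alternating_def)

lemma alternating_Cons:
  "alternating F (x # xs) \<longleftrightarrow> xs = [] \<or> x < hd xs \<and> F x * F (hd xs) < 0 \<and> alternating F xs"
  by (cases xs) auto

lemma sign_changes_leI:
  "(\<And>xs. set xs \<subseteq> D \<Longrightarrow> alternating F xs \<Longrightarrow> length xs \<le> Suc n) \<Longrightarrow> sign_changes_le D F n"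
  by (auto simp: sign_changes_le_def)

lemma sign_changes_leD:
  "sign_changes_le D F n \<Longrightarrow> set xs \<subseteq> D \<Longrightarrow> alternating F xs \<Longrightarrow> length xs \<le> Suc n"
  by (auto simp: sign_changes_le_def)

lemma sign_changes_le_mono: "sign_changes_le D F m \<Longrightarrow> m \<le> n \<Longrightarrow> sign_changes_le D F n"
  by (meson le_trans Suc_le_mono sign_changes_le_def)

lemma alternating_mult_pos:
  assumes "\<And>x. x \<in> set xs \<Longrightarrow> w x > (0::real)" "alternating (\<lambda>x. w x * F x) xs"
  shows "alternating F xs"
  using assms
proof (induction xs rule: induct_list012)
  case (3 x y zs)
  have "w x > 0" "w y > 0" using 3(3) by auto
  then have "w x * w y > 0" by simp
  moreover have "(w x * w y) * (F x * F y) < 0" using 3(4) by (simp add: mult_ac)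
  ultimately have "F x * F y < 0"
    using mult_less_cancel_left_pos[of "w x * w y" "F x * F y" 0] by simp
  then show ?case using 3 by auto
qed auto

lemma sign_changes_le_mult_pos:
  assumes "\<And>x. x \<in> D \<Longrightarrow> w x > 0" "sign_changes_le D F n"
  shows "sign_changes_le D (\<lambda>x. w x * F x) n"
proof (rule sign_changes_leI)
  fix xs assume "set xs \<subseteq> D" "alternating (\<lambda>x. w x * F x) xs"
  then show "length xs \<le> Suc n"
    using alternating_mult_pos[of xs w F] assms sign_changes_leD by blast
qed

lemma sign_changes_le_cong:
  assumes "\<And>x. x \<in> D \<Longrightarrow> F x = G x" "sign_changes_le D F n"
  shows "sign_changes_le D G n"
proof (rule sign_changes_leI)
  fix xs assume xs: "set xs \<subseteq> D" "alternating G xs"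
  have "alternating F ys" if "set ys \<subseteq> D" "alternating G ys" for ys
    using that by (induction ys rule: induct_list012) (auto simp: assms(1))
  then show "length xs \<le> Suc n" using xs assms(2) sign_changes_leD by blast
qed

lemma sign_changes_le_0:
  assumes "\<And>x y. x \<in> D \<Longrightarrow> y \<in> D \<Longrightarrow> F x * F y \<ge> 0"
  shows "sign_changes_le D F 0"
proof (rule sign_changes_leI)
  fix xs assume "set xs \<subseteq> D" "alternating F xs"
  then show "length xs \<le> Suc 0"
    using assms by (cases xs rule: remdups_adj.cases) (auto simp: not_le[symmetric])
qed

text \<open>Where a product changes sign, exactly one factor does. Walking through the list from the right, the
new point is prepended to the witness of that factor, and replaces the head of the witness of the
other factor, which has the same sign there; so both heads always stay at the current point.\<close>

lemma alternating_mult_split: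
  assumes "alternating (\<lambda>x. F x * G x) xs" "xs \<noteq> []"
  shows "\<exists>ys zs. ys \<noteq> [] \<and> zs \<noteq> [] \<and> hd ys = hd xs \<and> hd zs = hd xs \<and>
           set ys \<subseteq> set xs \<and> set zs \<subseteq> set xs \<and> alternating F ys \<and> alternating G zs \<and>
           length xs < length ys + length zs"
  using assms
proof (induction xs rule: induct_list012)
  case (2 x)
  show ?case by (rule exI[of _ "[x]"], rule exI[of _ "[x]"]) auto
next
  case (3 a b xs)
  obtain ys zs where ih: "hd ys = b" "hd zs = b" "set ys \<subseteq> set (b # xs)"
      "set zs \<subseteq> set (b # xs)" "alternating F ys" "alternating G zs"
      "length (b # xs) < length ys + length zs" and ne: "ys \<noteq> []" "zs \<noteq> []"
    using 3 by auto
  obtain ys' zs' where ys: "ys = b # ys'" and zs: "zs = b # zs'"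
    using ne ih(1,2) by (metis list.collapse)
  have ab: "a < b" and neg: "(F a * F b) * (G a * G b) < 0"
    using "3.prems"(1) by (auto simp: mult_ac)
  have replace: "alternating H (a # us)" if "alternating H (b # us)" "H a * H b > 0" for H us
  proof (cases us)
    case (Cons c cs)
    then have bc: "b < c" "H b * H c < 0" using that by auto
    then have "H a * H c < 0"
      using that(2) by (auto simp: mult_less_0_iff zero_less_mult_iff)
    then show ?thesis using that Cons ab bc by auto
  qed auto
  show ?case
  proof (cases "F a * F b < 0")
    case True
    then have "G a * G b > 0"
      using neg by (auto simp: mult_less_0_iff zero_less_mult_iff)
    then show ?thesis
      using True ih ab replace[of G zs'] unfolding ys zs
      by (intro exI[of _ "a # b # ys'"] exI[of _ "a # zs'"]) auto
  next
    case False
    then have "F a * F b > 0" "G a * G b < 0"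
      using neg by (auto simp: mult_less_0_iff zero_less_mult_iff)
    then show ?thesis
      using ih ab replace[of F ys'] unfolding ys zs
      by (intro exI[of _ "a # ys'"] exI[of _ "a # b # zs'"]) auto
  qed
qed auto

lemma sign_changes_le_mult:
  assumes "sign_changes_le D F m" "sign_changes_le D G n"
  shows "sign_changes_le D (\<lambda>x. F x * G x) (m + n)"
proof (rule sign_changes_leI)
  fix xs assume xs: "set xs \<subseteq> D" "alternating (\<lambda>x. F x * G x) xs"
  show "length xs \<le> Suc (m + n)"
  proof (cases "xs = []")
    case False
    then obtain ys zs where "set ys \<subseteq> set xs" "set zs \<subseteq> set xs" "alternating F ys"
        "alternating G zs" "length xs < length ys + length zs"
      using alternating_mult_split[OF xs(2)] by blast
    then have "length ys \<le> Suc m" "length zs \<le> Suc n"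
      using assms xs(1) unfolding sign_changes_le_def by (meson subset_trans)+
    with \<open>length xs < _\<close> show ?thesis by simp
  qed auto
qed

section \<open>Sign changes of a function and of its derivative\<close>

definition roots_above :: "real poly \<Rightarrow> real \<Rightarrow> nat" where
  "roots_above p a = size (filter_mset (\<lambda>z. a < z) (proots p))"

lemma roots_above_le_degree: "roots_above p a \<le> degree p"
  unfolding roots_above_def using size_filter_mset_lesseq size_proots_le le_trans by blast

lemma roots_above_split:
  assumes "a < b" "poly p b \<noteq> 0"
  shows "roots_above p a = size (filter_mset (\<lambda>z. a < z \<and> z < b) (proots p)) + roots_above p b"
proof -
  have "p \<noteq> 0" using assms by auto
  then have "filter_mset (\<lambda>z. a < z) (proots p) =
        filter_mset (\<lambda>z. a < z \<and> z < b) (proots p) + filter_mset (\<lambda>z. b < z) (proots p)"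
    using assms by (intro multiset_eqI) (auto simp: order_root)
  then show ?thesis by (simp add: roots_above_def)
qed

lemma poly_same_sign:
  assumes "a < b" "poly p a \<noteq> 0" "poly p b \<noteq> 0"
    "\<And>z. a < z \<Longrightarrow> z < b \<Longrightarrow> poly p z \<noteq> (0::real)"
  shows "poly p a * poly p b > 0"
  using poly_IVT[of a b p] assms by (metis linorder_neqE_linordered_idom mult_eq_0_iff)

text \<open>All that matters about the roots of a polynomial between two points: either there are none, or
exactly one simple root, which flips the sign, or the count with multiplicity drops by at least two.\<close>

lemma roots_above_cases:
  assumes "a < b" "poly p a \<noteq> 0" "poly p b \<noteq> 0"
  obtains (none) "roots_above p a = roots_above p b" "\<And>z. a \<le> z \<Longrightarrow> z \<le> b \<Longrightarrow> poly p z \<noteq> 0"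
      "poly p a * poly p b > 0"
    | (one) "roots_above p a = Suc (roots_above p b)" "poly p a * poly p b < 0"
    | (more) "Suc (Suc (roots_above p b)) \<le> roots_above p a"
proof -
  have p: "p \<noteq> 0" using assms by auto
  define M where "M = filter_mset (\<lambda>z. a < z \<and> z < b) (proots p)"
  have split: "roots_above p a = size M + roots_above p b"
    using roots_above_split assms M_def by blast
  consider "size M = 0" | "size M = 1" | "size M \<ge> 2" by linarith
  then show ?thesis
  proof cases
    case 1
    have nz: "poly p z \<noteq> 0" if "a < z" "z < b" for z
    proof
      assume "poly p z = 0"
      then have "z \<in># M" using that p by (simp add: M_def)
      then show False using 1 by simp
    qed
    moreover have "poly p a * poly p b > 0" by (rule poly_same_sign) (use assms nz in auto)
    moreover have "poly p z \<noteq> 0" if "a \<le> z" "z \<le> b" for z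
      using nz[of z] assms that by (cases "z = a"; cases "z = b") auto
    ultimately show ?thesis using none split 1 by simp
  next
    case 2
    then obtain z where M: "M = {#z#}" using size_1_singleton_mset by blast
    then have "z \<in># M" by simp
    then have z: "a < z" "z < b" "poly p z = 0" using p by (auto simp: M_def)
    obtain q where q: "p = [:- z, 1:] * q" using z(3) poly_eq_0_iff_dvd by blast
    then have q0: "q \<noteq> 0" using p by auto
    have "proots p = {#z#} + proots q"
      unfolding q by (subst proots_mult) (use q0 in auto)
    then have Mq: "M = {#z#} + filter_mset (\<lambda>z. a < z \<and> z < b) (proots q)"
      using z by (simp add: M_def)
    then have empty: "filter_mset (\<lambda>z. a < z \<and> z < b) (proots q) = {#}" using M by simp
    have "poly q a * poly q b > 0"
    proof (rule poly_same_sign)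
      fix w assume w: "a < w" "w < b"
      show "poly q w \<noteq> 0"
      proof
        assume "poly q w = 0"
        then have "w \<in># filter_mset (\<lambda>z. a < z \<and> z < b) (proots q)" using q0 w by auto
        then show False using empty by simp
      qed
    qed (use assms q in auto)
    moreover have "(a - z) * (b - z) < 0" using z by (simp add: mult_less_0_iff)
    moreover have "poly p a * poly p b = ((a - z) * (b - z)) * (poly q a * poly q b)"
      by (simp add: q mult_ac algebra_simps)
    ultimately have "poly p a * poly p b < 0" by (simp add: mult_less_0_iff)
    then show ?thesis using one split 2 by simp
  next
    case 3 then show ?thesis using more split by simp
  qed
qed

lemma eventually_poly_nonzero_at_right:
  assumes "p \<noteq> 0"
  shows "\<forall>\<^sub>F d in at_right 0. poly p (x + d) \<noteq> (0::real)"
proof -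
  have "p \<circ>\<^sub>p [:x, 1:] \<noteq> 0" using assms by (simp add: pcompose_eq_0_iff)
  then have fin: "finite {d. poly (p \<circ>\<^sub>p [:x, 1:]) d = 0}" by (rule poly_roots_finite)
  have "\<forall>\<^sub>F d in at_right 0. d \<notin> {d. poly (p \<circ>\<^sub>p [:x, 1:]) d = 0} - {0}"
  proof -
    have "open (- ({d. poly (p \<circ>\<^sub>p [:x, 1:]) d = 0} - {0}))"
      using fin by (intro open_Compl finite_imp_closed) auto
    then have "\<forall>\<^sub>F d in nhds 0. d \<in> - ({d. poly (p \<circ>\<^sub>p [:x, 1:]) d = 0} - {0})"
      by (intro eventually_nhds_in_open) auto
    then show ?thesis unfolding eventually_at_filter by eventually_elim auto
  qed
  moreover have "\<forall>\<^sub>F d in at_right 0. d \<noteq> (0::real)"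
    by (simp add: eventually_at_filter)
  ultimately show ?thesis
    by eventually_elim (simp add: poly_pcompose)
qed

text \<open>Shifting all points of an alternation by the same small amount moves them off the roots of a given
polynomial; \<open>sign_change_budget\<close> is stated for such points.\<close>

lemma eventually_shift_right:
  fixes H :: "real \<Rightarrow> real"
  assumes "open D" "continuous_on D H" "p \<noteq> 0" "set xs \<subseteq> D" "alternating H xs"
  shows "\<forall>\<^sub>F d in at_right 0. alternating H (map (\<lambda>x. x + d) xs) \<and>
           (\<forall>x\<in>set xs. x + d \<in> D \<and> poly p (x + d) \<noteq> 0)"
proof -
  have lim: "((\<lambda>d. x + d) \<longlongrightarrow> x) (at_right 0)" for x :: real
    by (rule tendsto_eq_intros | simp)+
  have inD: "\<forall>\<^sub>F d in at_right 0. x + d \<in> D" if "x \<in> D" for x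
    using topological_tendstoD[OF lim \<open>open D\<close> that] .
  have limH: "((\<lambda>d. H (x + d)) \<longlongrightarrow> H x) (at_right 0)" if "x \<in> D" for x
    using assms(1,2) that lim
    by (intro isCont_tendsto_compose[of x H]) (auto simp: continuous_on_eq_continuous_at)
  show ?thesis
    using assms(4,5)
  proof (induction xs rule: induct_list012)
    case (2 x)
    then show ?case
      using inD[of x] eventually_poly_nonzero_at_right[OF assms(3), of x]
      by (auto elim: eventually_elim2)
  next
    case (3 x y zs)
    have "((\<lambda>d. H (x + d) * H (y + d)) \<longlongrightarrow> H x * H y) (at_right 0)"
      using 3(3) by (intro tendsto_mult limH) auto
    then have "\<forall>\<^sub>F d in at_right 0. H (x + d) * H (y + d) < 0"
      using 3(4) by (auto intro: order_tendstoD)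
    moreover have "\<forall>\<^sub>F d in at_right 0. x + d \<in> D" using 3(3) inD by auto
    moreover have "\<forall>\<^sub>F d in at_right 0. poly p (x + d) \<noteq> 0"
      by (rule eventually_poly_nonzero_at_right) fact
    moreover have "\<forall>\<^sub>F d in at_right 0. alternating H (map (\<lambda>x. x + d) (y # zs)) \<and>
           (\<forall>x\<in>set (y # zs). x + d \<in> D \<and> poly p (x + d) \<noteq> 0)"
      using 3 by auto
    ultimately show ?case by eventually_elim (use 3(4) in auto)
  qed auto
qed

text \<open>The mean value theorem for \<open>H / p\<close>, whose derivative is a positive multiple of \<open>p H' - p' H\<close>.\<close>

lemma sign_of_quotient_derivative:
  fixes H H' :: "real \<Rightarrow> real"
  assumes ab: "a < b" and H: "\<And>x. a \<le> x \<Longrightarrow> x \<le> b \<Longrightarrow> (H has_real_derivative H' x) (at x)"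
    and p: "\<And>x. a \<le> x \<Longrightarrow> x \<le> b \<Longrightarrow> poly p x \<noteq> 0"
    and sgn: "H a * H b < 0" "poly p a * poly p b > 0"
  obtains z where "a < z" "z < b"
    "(poly p z * H' z - poly (pderiv p) z * H z) * (H a * poly p a) < 0"
proof -
  let ?g = "\<lambda>x. H x / poly p x"
  let ?N = "\<lambda>z. poly p z * H' z - poly (pderiv p) z * H z"
  have "\<exists>z. a < z \<and> z < b \<and> ?g b - ?g a = (b - a) * (?N z / (poly p z)^2)"
    using p
    by (intro MVT2 ab) (auto intro!: derivative_eq_intros H simp: power2_eq_square divide_simps algebra_simps)
  then obtain z where z: "a < z" "z < b"
    and eq: "?g b - ?g a = (b - a) * (?N z / (poly p z)^2)" by blast
  have pz: "(poly p z)^2 > 0" using p[of z] z by simp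
  have pa: "poly p a \<noteq> 0" "poly p b \<noteq> 0" using sgn by auto
  have ga: "?g a * (H a * poly p a) = (H a)^2"
    using pa by (simp add: power2_eq_square)
  have gb: "?g b * (H a * poly p a) = (H a * H b) * (poly p a * poly p b) / (poly p b)^2"
    using pa by (simp add: power2_eq_square)
  have "(H a * H b) * (poly p a * poly p b) / (poly p b)^2 < 0"
    using sgn pa by (intro divide_neg_pos[OF mult_neg_pos]) auto
  then have "(?g b - ?g a) * (H a * poly p a) < 0"
    unfolding left_diff_distrib ga gb by (smt (verit) zero_le_power2)
  then have "((b - a) / (poly p z)^2) * (?N z * (H a * poly p a)) < 0"
    unfolding eq by (simp add: mult_ac)
  moreover have "(b - a) / (poly p z)^2 > 0" using ab pz by simp
  ultimately have "?N z * (H a * poly p a) < 0"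
    using mult_less_cancel_left_pos[of "(b - a) / (poly p z)^2" "?N z * (H a * poly p a)" 0] by simp
  then show ?thesis using that z by blast
qed

text \<open>The combinatorial core. Write \<open>g = H / p\<close>, so that \<open>N p\<close> has the sign of the derivative of \<open>g\<close>. Going
through an alternation of \<open>H\<close> from right to left, each new gap must be paid for by a root of \<open>p\<close> or by
a new point in an alternation of \<open>N p\<close>. A gap without roots offers a point where \<open>N p\<close> has the sign
opposite to \<open>g\<close> at the left end; that point may fail to continue the alternation, but only after
some earlier gap was overpaid. Hence the clause about equality: if nothing has been overpaid,
then the sign of \<open>N p\<close> at the current head is opposite to that of \<open>g\<close>. A single simple
root preserves this clause, since \<open>H\<close> and \<open>p\<close> both flip and so \<open>g\<close> has equal signs at the two ends of the gap; two
or more roots overpay.\<close>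

lemma sign_change_budget:
  fixes H H' :: "real \<Rightarrow> real"
  defines "N \<equiv> \<lambda>p x. poly p x * H' x - poly (pderiv p) x * H x"
  assumes D: "is_interval D"
    and H: "\<And>x. x \<in> D \<Longrightarrow> (H has_real_derivative H' x) (at x)"
    and xs: "set xs \<subseteq> D" "alternating H xs" "xs \<noteq> []" "\<And>x. x \<in> set xs \<Longrightarrow> poly p x \<noteq> 0"
  shows "\<exists>ys. set ys \<subseteq> D \<and> alternating (N p) ys \<and> (\<forall>y\<in>set ys. hd xs < y \<and> N p y \<noteq> 0) \<and>
           length xs \<le> Suc (roots_above p (hd xs) + length ys) \<and>
           (length xs = Suc (roots_above p (hd xs) + length ys) \<longrightarrow>
              ys = [] \<or> N p (hd ys) * (H (hd xs) * poly p (hd xs)) < 0)"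
  using xs
proof (induction xs rule: induct_list012)
  case (2 x)
  show ?case by (rule exI[of _ "[]"]) auto
next
  case (3 a b xs)
  obtain ys where ys: "set ys \<subseteq> D" "alternating (N p) ys" "\<forall>y\<in>set ys. b < y \<and> N p y \<noteq> 0"
    and len: "length (b # xs) \<le> Suc (roots_above p b + length ys)"
    and tight: "length (b # xs) = Suc (roots_above p b + length ys) \<Longrightarrow>
              ys = [] \<or> N p (hd ys) * (H b * poly p b) < 0"
    using 3 by auto
  have ab: "a < b" "H a * H b < 0" "poly p a \<noteq> 0" "poly p b \<noteq> 0" and inD: "a \<in> D" "b \<in> D"
    using 3 by auto
  have ys_a: "\<forall>y\<in>set ys. a < y \<and> N p y \<noteq> 0" using ys(3) ab by force
  from ab(1,3,4) show ?case
  proof (cases rule: roots_above_cases)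
    case none
    obtain z where z: "a < z" "z < b" and Nz: "N p z * (H a * poly p a) < 0"
      unfolding N_def
      by (rule sign_of_quotient_derivative[of a b H H' p])
         (use ab none inD in \<open>auto intro!: H intro: mem_is_interval_1_I[OF D inD]\<close>)
    have zD: "z \<in> D" using mem_is_interval_1_I[OF D inD] z by simp
    have flip: "(H a * poly p a) * (H b * poly p b) < 0"
    proof -
      have "(H a * H b) * (poly p a * poly p b) < 0" using ab(2) none(3) by (rule mult_neg_pos)
      then show ?thesis by (simp add: mult_ac)
    qed
    have Nz0: "N p z \<noteq> 0" using Nz by auto
    \<comment> \<open>The new point extends the alternation if that is empty or its head has the opposite sign.\<close>
    show ?thesis
    proof (cases "ys = [] \<or> N p (hd ys) * (H b * poly p b) < 0")
      case True
      have "alternating (N p) (z # ys)"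
      proof (cases "ys = []")
        case False
        then have "N p (hd ys) * (H b * poly p b) < 0" using True by auto
        then have "N p z * N p (hd ys) < 0"
          using Nz flip by (auto simp: mult_less_0_iff zero_less_mult_iff)
        moreover have "z < hd ys" using bspec[OF ys(3) hd_in_set[OF False]] z by simp
        ultimately show ?thesis using ys(2) by (auto simp: alternating_Cons)
      qed simp
      then show ?thesis
        using ys(1) zD z ys_a len none(1) Nz Nz0 by (intro exI[of _ "z # ys"]) auto
    next
      case False
      then have "N p (hd ys) \<noteq> 0" using ys(3) by simp
      then have "N p (hd ys) * (H a * poly p a) < 0"
        using False flip by (auto simp: mult_less_0_iff not_less zero_le_mult_iff)
      moreover have "length (b # xs) < Suc (roots_above p b + length ys)"
        using False tight len by linarith
      ultimately show ?thesis
        using ys(1,2) ys_a none(1) by (intro exI[of _ ys]) auto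
    qed
  next
    case one
    have "(H a * H b) * (poly p a * poly p b) > 0" using ab(2) one(2) by (rule mult_neg_neg)
    then have same: "(H a * poly p a) * (H b * poly p b) > 0" by (simp add: mult_ac)
    have "N p (hd ys) * (H a * poly p a) < 0" if "N p (hd ys) * (H b * poly p b) < 0"
      using that same by (auto simp: mult_less_0_iff zero_less_mult_iff)
    then show ?thesis
      using ys(1,2) ys_a len one(1) tight by (intro exI[of _ ys]) auto
  next
    case more
    then show ?thesis
      using ys(1,2) ys_a len by (intro exI[of _ ys]) auto
  qed
qed auto

text \<open>A Rolle theorem for the quotient \<open>H / p\<close> that counts sign changes and allows for poles: every root
of \<open>p\<close> costs one sign change, although a pole may both interrupt the interval and
change the sign.\<close>

lemma sign_changes_le_quotient:
  fixes H H' :: "real \<Rightarrow> real"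
  assumes "open D" and D: "is_interval D"
    and H: "\<And>x. x \<in> D \<Longrightarrow> (H has_real_derivative H' x) (at x)"
    and "p \<noteq> 0"
    and N: "sign_changes_le D (\<lambda>x. poly p x * H' x - poly (pderiv p) x * H x) n"
  shows "sign_changes_le D H (Suc (degree p + n))"
proof (rule sign_changes_leI)
  fix xs assume xs: "set xs \<subseteq> D" "alternating H xs"
  have cont: "continuous_on D H"
    using H by (meson DERIV_isCont continuous_at_imp_continuous_on)
  obtain d where d: "alternating H (map (\<lambda>x. x + d) xs)"
      "\<forall>x\<in>set xs. x + d \<in> D \<and> poly p (x + d) \<noteq> 0"
    using eventually_happens[OF eventually_shift_right[OF assms(1) cont \<open>p \<noteq> 0\<close> xs]] by auto
  define xs' where "xs' = map (\<lambda>x. x + d) xs"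
  show "length xs \<le> Suc (Suc (degree p + n))"
  proof (cases "xs = []")
    case False
    have "set xs' \<subseteq> D" "alternating H xs'" "xs' \<noteq> []" "\<And>x. x \<in> set xs' \<Longrightarrow> poly p x \<noteq> 0"
      using d False by (auto simp: xs'_def)
    from sign_change_budget[OF D H this]
    obtain ys where "set ys \<subseteq> D" "alternating (\<lambda>x. poly p x * H' x - poly (pderiv p) x * H x) ys"
        "length xs' \<le> Suc (roots_above p (hd xs') + length ys)"
      by blast
    moreover from this(1,2) have "length ys \<le> Suc n" using sign_changes_leD[OF N] by blast
    ultimately show ?thesis
      using roots_above_le_degree[of p "hd xs'"] by (simp add: xs'_def)
  qed auto
qed

lemma sign_changes_le_deriv:
  fixes H H' :: "real \<Rightarrow> real"
  assumes "open D" "is_interval D"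
    "\<And>x. x \<in> D \<Longrightarrow> (H has_real_derivative H' x) (at x)" "sign_changes_le D H' n"
  shows "sign_changes_le D H (Suc n)"
  using sign_changes_le_quotient[OF assms(1-3), of 1 n] assms(4) by simp

lemma sign_changes_le_poly:
  assumes "open D" "is_interval D"
  shows "sign_changes_le D (poly p) (degree p)"
proof (induction "degree p" arbitrary: p)
  case 0
  then obtain c where "p = [:c:]" using degree_eq_zeroE by metis
  then have "sign_changes_le D (poly p) 0" by (intro sign_changes_le_0) simp
  then show ?case using 0 by simp
next
  case (Suc n)
  have "sign_changes_le D (poly (pderiv p)) n"
    using Suc(1)[of "pderiv p"] Suc(2)[symmetric] by (simp add: degree_pderiv)
  then show ?case
    unfolding Suc(2)[symmetric] by (rule sign_changes_le_deriv[OF assms poly_DERIV])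
qed

text \<open>Between consecutive zeros a function leaves zero and returns, so its derivative takes both signs.\<close>

lemma zero_gap_derivative_signs:
  fixes f f' :: "real \<Rightarrow> real"
  assumes "a < b" "\<And>x. a \<le> x \<Longrightarrow> x \<le> b \<Longrightarrow> (f has_real_derivative f' x) (at x)"
    "f a = 0" "f b = 0" "\<And>x. a < x \<Longrightarrow> x < b \<Longrightarrow> f x \<noteq> 0"
  obtains u v where "a < u" "u < v" "v < b" "f' u * f' v < 0"
proof -
  define m where "m = (a + b) / 2"
  have m: "a < m" "m < b" using assms(1) by (auto simp: m_def)
  obtain u where u: "a < u" "u < m" "f m - f a = (m - a) * f' u"
    using MVT2[of a m f f'] m assms(2) by auto
  obtain v where v: "m < v" "v < b" "f b - f m = (b - m) * f' v"
    using MVT2[of m b f f'] m assms(2) by auto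
  have "f m \<noteq> 0" using assms m by auto
  then have "f m * f m > 0" by (simp add: zero_less_mult_iff linorder_neq_iff disj_commute)
  have "((m - a) * (b - m)) * (f' u * f' v) = - (f m * f m)"
  proof -
    have "((m - a) * (b - m)) * (f' u * f' v) = ((m - a) * f' u) * ((b - m) * f' v)" by simp
    also have "(m - a) * f' u = f m" using u(3) assms by simp
    also have "(b - m) * f' v = - f m" using v(3) assms by simp
    finally show ?thesis by simp
  qed
  then have "((m - a) * (b - m)) * (f' u * f' v) < 0" using \<open>f m * f m > 0\<close> by simp
  moreover have "(m - a) * (b - m) > 0" using m by simp
  ultimately have "f' u * f' v < 0"
    using mult_less_cancel_left_pos[of "(m - a) * (b - m)" "f' u * f' v" 0] by simp
  then show ?thesis using u v by (intro that[of u v]) auto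
qed

text \<open>As both signs of the derivative are available in every gap, the first sign can be prescribed,
and one point per gap can be chosen so that the signs alternate.\<close>

lemma alternating_derivative_of_zeros:
  fixes f f' :: "real \<Rightarrow> real"
  assumes D: "is_interval D"
    and f': "\<And>x. x \<in> D \<Longrightarrow> (f has_real_derivative f' x) (at x)"
    and xs: "set xs \<subseteq> D" "xs \<noteq> []" "\<And>x. x \<in> set xs \<Longrightarrow> f x = 0"
      "successively (\<lambda>x y. x < y \<and> (\<forall>z. x < z \<longrightarrow> z < y \<longrightarrow> f z \<noteq> 0)) xs"
    and "s \<noteq> (0::real)"
  shows "\<exists>ys. set ys \<subseteq> D \<and> alternating f' ys \<and> (\<forall>y\<in>set ys. hd xs < y) \<and>
           length xs = Suc (length ys) \<and> (ys \<noteq> [] \<longrightarrow> s * f' (hd ys) > 0)"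
  using xs \<open>s \<noteq> 0\<close>
proof (induction xs arbitrary: s rule: induct_list012)
  case (2 x)
  show ?case by (rule exI[of _ "[]"]) auto
next
  case (3 a b xs)
  have ab: "a \<in> D" "b \<in> D" "a < b" "f a = 0" "f b = 0" "\<And>z. a < z \<Longrightarrow> z < b \<Longrightarrow> f z \<noteq> 0"
    using 3 by auto
  obtain u v where uv: "a < u" "u < v" "v < b" "f' u * f' v < 0"
    by (rule zero_gap_derivative_signs[of a b f f']) (use ab f' mem_is_interval_1_I[OF D ab(1,2)] in auto)
  have "u \<in> D" "v \<in> D" using mem_is_interval_1_I[OF D ab(1,2)] uv by auto
  have "s * f' u > 0 \<or> s * f' v > 0"
    using uv(4) \<open>s \<noteq> 0\<close> by (auto simp: mult_less_0_iff zero_less_mult_iff)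
  then obtain w where w: "a < w" "w < b" "w \<in> D" "s * f' w > 0"
    using uv \<open>u \<in> D\<close> \<open>v \<in> D\<close> by (meson less_trans)
  obtain ys where ys: "set ys \<subseteq> D" "alternating f' ys" "\<forall>y\<in>set ys. b < y"
      "length (b # xs) = Suc (length ys)" "ys \<noteq> [] \<Longrightarrow> - s * f' (hd ys) > 0"
    using 3(2)[of "-s"] 3 by auto
  have "alternating f' (w # ys)"
  proof (cases "ys = []")
    case False
    then have "w < hd ys" using bspec[OF ys(3) hd_in_set[OF False]] w by simp
    moreover have "f' w * f' (hd ys) < 0"
      using ys(5)[OF False] w(4) by (auto simp: mult_less_0_iff zero_less_mult_iff)
    ultimately show ?thesis using ys(2) by (auto simp: alternating_Cons)
  qed simp
  then show ?case using ys w by (intro exI[of _ "w # ys"]) force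
qed auto

text \<open>Zeros where the function does not change sign are counted as well: two points are taken from the
first gap and one from each other gap, which gives as many alternating points as there are zeros.\<close>

lemma card_zeros_le_sign_changes_deriv:
  fixes f f' :: "real \<Rightarrow> real"
  assumes D: "is_interval D"
    and f': "\<And>x. x \<in> D \<Longrightarrow> (f has_real_derivative f' x) (at x)"
    and fin: "finite {x \<in> D. f x = 0}" and sc: "sign_changes_le D f' n"
  shows "card {x \<in> D. f x = 0} \<le> Suc n"
proof -
  define xs where "xs = sorted_list_of_set {x \<in> D. f x = 0}"
  have set_xs: "set xs = {x \<in> D. f x = 0}" and len: "length xs = card {x \<in> D. f x = 0}"
    using fin by (auto simp: xs_def)
  have sorted: "sorted_wrt (<) xs" by (simp add: xs_def)
  have gaps: "successively (\<lambda>x y. x < y \<and> (\<forall>z. x < z \<longrightarrow> z < y \<longrightarrow> f z \<noteq> 0)) xs"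
    unfolding successively_conv_nth
  proof (intro allI impI conjI notI)
    fix i assume i: "Suc i < length xs"
    show "xs ! i < xs ! Suc i" using sorted i by (simp add: sorted_wrt_nth_less)
    fix z assume z: "xs ! i < z" "z < xs ! Suc i" "f z = 0"
    have "xs ! i \<in> D" "xs ! Suc i \<in> D" using set_xs i nth_mem[of i xs] nth_mem[of "Suc i" xs] by auto
    then have "z \<in> set xs" using z set_xs mem_is_interval_1_I[OF D, of "xs ! i" "xs ! Suc i" z] by auto
    then obtain j where j: "j < length xs" "z = xs ! j" by (auto simp: in_set_conv_nth)
    have "i < j \<and> j < Suc i"
      using z(1,2) j i sorted by (metis linorder_neqE_nat less_asym less_irrefl sorted_wrt_nth_less Suc_lessD)
    then show False by auto
  qed
  consider "xs = []" | a where "xs = [a]" | a b ys where "xs = a # b # ys"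
    by (cases xs rule: remdups_adj.cases) auto
  then show ?thesis
  proof cases
    case (3 a b zs)
    have ab: "a \<in> D" "b \<in> D" "a < b" "f a = 0" "f b = 0" "\<And>z. a < z \<Longrightarrow> z < b \<Longrightarrow> f z \<noteq> 0"
      using set_xs gaps unfolding 3 by auto
    obtain u v where uv: "a < u" "u < v" "v < b" "f' u * f' v < 0"
      by (rule zero_gap_derivative_signs[of a b f f']) (use ab f' mem_is_interval_1_I[OF D ab(1,2)] in auto)
    have uvD: "u \<in> D" "v \<in> D" using mem_is_interval_1_I[OF D ab(1,2)] uv by auto
    have "f' u \<noteq> 0" using uv by auto
    obtain ys where ys: "set ys \<subseteq> D" "alternating f' ys" "\<forall>y\<in>set ys. b < y"
        "length (b # zs) = Suc (length ys)" "ys \<noteq> [] \<Longrightarrow> f' u * f' (hd ys) > 0"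
      using alternating_derivative_of_zeros[of D f f' "b # zs" "f' u"] D f' set_xs gaps \<open>f' u \<noteq> 0\<close>
      unfolding 3 by auto
    have "alternating f' (u # v # ys)"
    proof (cases "ys = []")
      case False
      then have "v < hd ys" using bspec[OF ys(3) hd_in_set[OF False]] uv by simp
      moreover have "f' v * f' (hd ys) < 0"
        using ys(5)[OF False] uv(4) by (auto simp: mult_less_0_iff zero_less_mult_iff)
      ultimately show ?thesis using ys(2) uv by (auto simp: alternating_Cons)
    qed (use uv in auto)
    then have "length (u # v # ys) \<le> Suc n"
      using sign_changes_leD[OF sc, of "u # v # ys"] ys(1) uvD by auto
    then show ?thesis using len ys(4) unfolding 3 by simp
  qed (use len in auto)
qed

section \<open>The Desnanot-Jacobi identity\<close>

text \<open>Schur complement without division: \<open>A\<close> times \<open>adj A\<close> is \<open>det A\<close> times the identity, so the column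
operations below clear the upper right block.\<close>

lemma det_bordered:
  fixes A :: "'a::idom mat"
  assumes A: "A \<in> carrier_mat n n" and B: "B \<in> carrier_mat n m"
    and C: "C \<in> carrier_mat m n" and D: "D \<in> carrier_mat m m"
    and nz: "Determinant.det A \<noteq> 0"
  shows "Determinant.det (four_block_mat A B C D) * Determinant.det A ^ m =
    Determinant.det A * Determinant.det (Determinant.det A \<cdot>\<^sub>m D - C * (adj_mat A * B))"
proof -
  let ?d = "Determinant.det A"
  let ?X = "adj_mat A * B"
  let ?U = "four_block_mat (1\<^sub>m n) (- ?X) (0\<^sub>m m n) (?d \<cdot>\<^sub>m 1\<^sub>m m)"
  note adj = adj_mat[OF A]
  have X: "?X \<in> carrier_mat n m" using adj(1) B by auto
  have CX: "C * ?X \<in> carrier_mat m m" using C X by auto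
  have AX: "A * ?X = ?d \<cdot>\<^sub>m B"
  proof -
    have "A * ?X = (A * adj_mat A) * B" using A adj(1) B by (simp add: assoc_mult_mat)
    also have "\<dots> = ?d \<cdot>\<^sub>m B" unfolding adj(2) using B
      by (simp add: mult_smult_assoc_mat[of "1\<^sub>m n" n n B m])
    finally show ?thesis .
  qed
  have "four_block_mat A B C D * ?U =
      four_block_mat (A * 1\<^sub>m n + B * 0\<^sub>m m n) (A * (- ?X) + B * (?d \<cdot>\<^sub>m 1\<^sub>m m))
        (C * 1\<^sub>m n + D * 0\<^sub>m m n) (C * (- ?X) + D * (?d \<cdot>\<^sub>m 1\<^sub>m m))"
    by (rule mult_four_block_mat[OF A B C D]) (use X in auto)
  also have "A * 1\<^sub>m n + B * 0\<^sub>m m n = A" using A B by simp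
  also have "A * (- ?X) + B * (?d \<cdot>\<^sub>m 1\<^sub>m m) = 0\<^sub>m n m"
  proof -
    have "A * (- ?X) = - (?d \<cdot>\<^sub>m B)" unfolding AX[symmetric] by (rule uminus_mult_right_mat) (use A B adj in auto)
    moreover have "B * (?d \<cdot>\<^sub>m 1\<^sub>m m) = ?d \<cdot>\<^sub>m B" 
      using B by (simp add: mult_smult_distrib[of B n m "1\<^sub>m m" m])
    ultimately show ?thesis using B by (auto intro!: eq_matI)
  qed
  also have "C * 1\<^sub>m n + D * 0\<^sub>m m n = C" using C D by simp
  also have "C * (- ?X) + D * (?d \<cdot>\<^sub>m 1\<^sub>m m) = ?d \<cdot>\<^sub>m D - C * ?X"
  proof -
    have "C * (- ?X) = - (C * ?X)" by (rule uminus_mult_right_mat) (use C X in auto)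
    moreover have "D * (?d \<cdot>\<^sub>m 1\<^sub>m m) = ?d \<cdot>\<^sub>m D" 
      using D by (simp add: mult_smult_distrib[of D m m "1\<^sub>m m" m])
    moreover have "- Y + Z = Z - Y" if "Y \<in> carrier_mat m m" "Z \<in> carrier_mat m m" for Y Z :: "'a mat"
      using that by (intro eq_matI) auto
    ultimately show ?thesis using D CX by simp
  qed
  finally have prod: "four_block_mat A B C D * ?U =
      four_block_mat A (0\<^sub>m n m) C (?d \<cdot>\<^sub>m D - C * ?X)" .
  have "Determinant.det ?U = ?d ^ m"
    by (subst det_four_block_mat_lower_left_zero[of _ n _ m]) (use X in auto)
  moreover have "Determinant.det (four_block_mat A B C D * ?U) =
      Determinant.det (four_block_mat A B C D) * Determinant.det ?U"
    by (rule det_mult[of _ "n + m"]) (use A D in auto)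
  moreover have "Determinant.det (four_block_mat A (0\<^sub>m n m) C (?d \<cdot>\<^sub>m D - C * ?X)) =
      ?d * Determinant.det (?d \<cdot>\<^sub>m D - C * ?X)"
    by (rule det_four_block_mat_upper_right_zero[OF A _ C]) (use minus_carrier_mat[OF CX] in auto)
  ultimately show ?thesis using prod by simp
qed

lemma det_2x2:
  fixes A :: "'a::comm_ring_1 mat"
  assumes A: "A \<in> carrier_mat 2 2"
  shows "Determinant.det A = A $$ (0,0) * A $$ (1,1) - A $$ (0,1) * A $$ (1,0)"
proof -
  have "Determinant.det A = (\<Sum>i<2. A $$ (i, 0) * cofactor A i 0)"
    using laplace_expansion_column[OF A, of 0] by simp
  also have "\<dots> = A $$ (0, 0) * A $$ (1, 1) - A $$ (0, 1) * A $$ (1, 0)"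
  proof -
    have "mat_delete A i 0 \<in> carrier_mat 1 1" for i using A by (auto simp: mat_delete_def)
    from det_single[OF this] show ?thesis
      using A by (simp add: numeral_2_eq_2 cofactor_def mat_delete_def)
  qed
  finally show ?thesis .
qed

text \<open>Rows and columns are given by lists, so that bordering a minor is appending to the lists.
The size is the number of columns, and the row list is meant to have the same length.\<close>

definition minor :: "(nat \<Rightarrow> 'i \<Rightarrow> 'a::comm_ring_1) \<Rightarrow> nat list \<Rightarrow> 'i list \<Rightarrow> 'a" where
  "minor M rs cs = Determinant.det
     (Matrix.mat (length cs) (length cs) (\<lambda>(r, c). M (rs ! r) (cs ! c)))"

text \<open>Over an integral domain, a bordered minor is, up to powers of \<open>d = minor M rs cs\<close>, the determinant of the
Schur complement entries \<open>S\<close>. For one extra row and column this is a single entry, for two it is a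
\<open>2 \<times> 2\<close> determinant, and the identity is the formula for the latter.\<close>

lemma desnanot_jacobi:
  fixes M :: "nat \<Rightarrow> 'i \<Rightarrow> 'a::idom"
  assumes len: "length rs = length cs" and nz: "minor M rs cs \<noteq> 0"
  shows "minor M (rs @ [r]) (cs @ [a]) * minor M (rs @ [s]) (cs @ [b]) -
         minor M (rs @ [s]) (cs @ [a]) * minor M (rs @ [r]) (cs @ [b]) =
         minor M rs cs * minor M (rs @ [r, s]) (cs @ [a, b])"
proof -
  let ?n = "length cs"
  define A where "A = Matrix.mat ?n ?n (\<lambda>(i, j). M (rs ! i) (cs ! j))"
  define d where "d = Determinant.det A"
  define B where "B us = Matrix.mat ?n (length us) (\<lambda>(i, j). M (rs ! i) (us ! j))" for us
  define C where "C ts = Matrix.mat (length ts) ?n (\<lambda>(i, j). M (ts ! i) (cs ! j))" for ts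
  define D where "D ts us = Matrix.mat (length us) (length us) (\<lambda>(i, j). M (ts ! i) (us ! j))" for ts us
  define S where "S t u = d * M t u - (C [t] * (adj_mat A * B [u])) $$ (0, 0)" for t u
  have dims: "A \<in> carrier_mat ?n ?n" "B us \<in> carrier_mat ?n (length us)"
    "C ts \<in> carrier_mat (length ts) ?n" "length ts = length us \<Longrightarrow> D ts us \<in> carrier_mat (length us) (length us)"
    for ts us
    by (auto simp: A_def B_def C_def D_def)
  have adj: "adj_mat A \<in> carrier_mat ?n ?n" using adj_mat(1)[OF dims(1)] .
  have d: "minor M rs cs = d" by (simp add: minor_def d_def A_def)
  have block: "minor M (rs @ ts) (cs @ us) * d ^ length us =
      d * Determinant.det (Matrix.mat (length us) (length us) (\<lambda>(i, j). S (ts ! i) (us ! j)))"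
    if "length ts = length us" for ts us
  proof -
    have "Matrix.mat (length (cs @ us)) (length (cs @ us)) (\<lambda>(i, j). M ((rs @ ts) ! i) ((cs @ us) ! j)) =
        four_block_mat A (B us) (C ts) (D ts us)"
      by (rule eq_matI) (use len that in \<open>auto simp: A_def B_def C_def D_def nth_append\<close>)
    then have "minor M (rs @ ts) (cs @ us) * d ^ length us =
        d * Determinant.det (d \<cdot>\<^sub>m D ts us - C ts * (adj_mat A * B us))"
      unfolding minor_def
      using det_bordered[of A ?n "B us" "length us" "C ts" "D ts us"] dims that nz d d_def by metis
    also have "d \<cdot>\<^sub>m D ts us - C ts * (adj_mat A * B us) =
        Matrix.mat (length us) (length us) (\<lambda>(i, j). S (ts ! i) (us ! j))"
    proof (rule eq_matI)
      fix i j assume ij: "i < dim_row (Matrix.mat (length us) (length us) (\<lambda>(i, j). S (ts ! i) (us ! j)))"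
        "j < dim_col (Matrix.mat (length us) (length us) (\<lambda>(i, j). S (ts ! i) (us ! j)))"
      then have i: "i < length us" "j < length us" by auto
      have rowC: "Matrix.row (C ts) i = Matrix.row (C [ts ! i]) 0"
        using i that by (intro eq_vecI) (auto simp: C_def)
      have colB: "Matrix.col (B us) j = Matrix.col (B [us ! j]) 0"
        using i by (intro eq_vecI) (auto simp: B_def)
      have colX: "Matrix.col (adj_mat A * B us) j = Matrix.col (adj_mat A * B [us ! j]) 0"
        using i dims adj colB by (intro eq_vecI) (auto simp: B_def)
      have "(C ts * (adj_mat A * B us)) $$ (i, j) = (C [ts ! i] * (adj_mat A * B [us ! j])) $$ (0, 0)"
        using i that rowC colX by (simp add: C_def B_def)
      then show "(d \<cdot>\<^sub>m D ts us - C ts * (adj_mat A * B us)) $$ (i, j) =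
          Matrix.mat (length us) (length us) (\<lambda>(i, j). S (ts ! i) (us ! j)) $$ (i, j)"
        using i that by (simp add: S_def D_def C_def B_def)
    qed (use that in \<open>auto simp: D_def C_def B_def\<close>)
    finally show ?thesis .
  qed
  have d0: "d \<noteq> 0" using nz d by simp
  have one: "minor M (rs @ [t]) (cs @ [u]) = S t u" for t u
  proof -
    have "minor M (rs @ [t]) (cs @ [u]) * d = d * S t u"
      using block[of "[t]" "[u]"] by (simp add: det_single[of "Matrix.mat (Suc 0) (Suc 0) _"])
    then show ?thesis using d0 by simp
  qed
  have "minor M (rs @ [r, s]) (cs @ [a, b]) * d ^ 2 = d * (S r a * S s b - S r b * S s a)"
    using block[of "[r, s]" "[a, b]"] det_2x2[of "Matrix.mat 2 2 (\<lambda>(i, j). S ([r, s] ! i) ([a, b] ! j))"]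
    by (simp add: numeral_2_eq_2)
  then have "minor M (rs @ [r, s]) (cs @ [a, b]) * d = S r a * S s b - S r b * S s a"
    using d0 by (simp add: power2_eq_square)
  then show ?thesis by (simp add: one d mult_ac)
qed

section \<open>Polynomial parts of Wronskians\<close>

text \<open>The pair \<open>e = (\<alpha>, \<beta>)\<close> stands for the function \<open>f\<^sub>e(x) = x\<^sup>\<alpha> (1 - x)\<^sup>\<beta>\<close> on \<open>(0, 1)\<close>. The derivation
\<open>\<theta> = x (1 - x) d/dx\<close> is used in place of \<open>d/dx\<close> because \<open>\<theta> f\<^sub>e\<close> is the polynomial
\<open>\<alpha> - (\<alpha> + \<beta>) x\<close> times \<open>f\<^sub>e\<close>. Hence \<open>\<theta> (p f\<^sub>e) = (twisted e p) f\<^sub>e\<close> for every polynomial \<open>p\<close>, the \<open>r\<close>-th iterate of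
\<open>\<theta>\<close> maps \<open>f\<^sub>e\<close> to \<open>jet r e\<close> times \<open>f\<^sub>e\<close>, and the Wronskian of several such functions with respect to
\<open>\<theta>\<close> is the product of the functions times the polynomial \<open>wronskian\<close> below.\<close>

type_synonym exponents = "real \<times> real"

definition logistic_factor :: "exponents \<Rightarrow> real poly" where
  "logistic_factor e = [:fst e, - (fst e + snd e):]"

definition euler :: "real poly \<Rightarrow> real poly" where
  "euler p = [:0, 1, -1:] * pderiv p"

definition twisted :: "exponents \<Rightarrow> real poly \<Rightarrow> real poly" where
  "twisted e p = euler p + logistic_factor e * p"

definition jet :: "nat \<Rightarrow> exponents \<Rightarrow> real poly" where
  "jet r e = (twisted e ^^ r) 1"

definition wronskian :: "exponents list \<Rightarrow> real poly" where
  "wronskian cs = minor jet [0..<length cs] cs"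

lemma jet_0 [simp]: "jet 0 e = 1"
  and jet_Suc: "jet (Suc r) e = twisted e (jet r e)"
  by (simp_all add: jet_def)

lemma euler_sum: "euler (sum f S) = (\<Sum>x\<in>S. euler (f x))"
  by (induction S rule: infinite_finite_induct) (auto simp: euler_def pderiv_add distrib_left)

lemma euler_prod: "euler (prod f S) = (\<Sum>x\<in>S. prod f (S - {x}) * euler (f x))"
  unfolding euler_def pderiv_prod sum_distrib_left by (intro sum.cong refl mult.left_commute)

lemma euler_signof: "euler (signof p * q) = signof p * euler q"
  by (cases "sign p = 1") (auto simp: sign_def euler_def pderiv_minus)

lemma permutes_nat_less: "p permutes {0..<n} \<Longrightarrow> i < n \<Longrightarrow> p i < (n::nat)"
  using permutes_in_image[of p "{0..<n}" i] by simp

text \<open>The Leibniz rule for determinants, with an additional weight \<open>w c\<close> attached to column \<open>c\<close>: it is the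
derivative of the determinant whose columns have been multiplied by functions with logarithmic
derivatives \<open>w c\<close>.\<close>

lemma euler_det:
  fixes M :: "nat \<Rightarrow> nat \<Rightarrow> real poly" and w :: "nat \<Rightarrow> real poly"
  shows "euler (Determinant.det (Matrix.mat n n (\<lambda>(r, c). M r c))) +
      (\<Sum>c<n. w c) * Determinant.det (Matrix.mat n n (\<lambda>(r, c). M r c)) =
    (\<Sum>k<n. Determinant.det (Matrix.mat n n
        (\<lambda>(r, c). if r = k then euler (M r c) + w c * M r c else M r c)))"
proof -
  let ?P = "{p. p permutes {0..<n}}"
  have expand: "Determinant.det (Matrix.mat n n (\<lambda>(r, c). A r c)) =
      (\<Sum>p\<in>?P. signof p * (\<Prod>i=0..<n. A i (p i)))" for A :: "nat \<Rightarrow> nat \<Rightarrow> real poly"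
    by (subst det_def'[of _ n]) (auto intro!: sum.cong prod.cong simp: permutes_nat_less)
  have single: "euler (\<Prod>i=0..<n. M i (p i)) + (\<Sum>c<n. w c) * (\<Prod>i=0..<n. M i (p i)) =
      (\<Sum>k<n. \<Prod>i=0..<n. if i = k then euler (M i (p i)) + w (p i) * M i (p i) else M i (p i))"
    if p: "p permutes {0..<n}" for p
  proof -
    have "(\<Sum>c<n. w c) = (\<Sum>k<n. w (p k))"
      using sum.permute[OF p, of w] by (simp add: atLeast0LessThan comp_def)
    then have "(\<Sum>c<n. w c) * (\<Prod>i=0..<n. M i (p i)) =
        (\<Sum>k<n. w (p k) * (\<Prod>i=0..<n. M i (p i)))"
      by (simp add: sum_distrib_right)
    also have "\<dots> = (\<Sum>k<n. (\<Prod>i\<in>{0..<n} - {k}. M i (p i)) * (w (p k) * M k (p k)))"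
    proof (rule sum.cong[OF refl])
      fix k assume "k \<in> {..<n}"
      then show "w (p k) * (\<Prod>i=0..<n. M i (p i)) =
          (\<Prod>i\<in>{0..<n} - {k}. M i (p i)) * (w (p k) * M k (p k))"
        by (subst prod.remove[of _ k]) (auto simp: mult_ac)
    qed
    finally have "euler (\<Prod>i=0..<n. M i (p i)) + (\<Sum>c<n. w c) * (\<Prod>i=0..<n. M i (p i)) =
        (\<Sum>k<n. (\<Prod>i\<in>{0..<n} - {k}. M i (p i)) * (euler (M k (p k)) + w (p k) * M k (p k)))"
      by (simp add: euler_prod atLeast0LessThan sum.distrib distrib_left)
    also have "\<dots> = (\<Sum>k<n. \<Prod>i=0..<n. if i = k then euler (M i (p i)) + w (p i) * M i (p i) else M i (p i))"
    proof (rule sum.cong[OF refl])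
      fix k assume "k \<in> {..<n}"
      then show "(\<Prod>i\<in>{0..<n} - {k}. M i (p i)) * (euler (M k (p k)) + w (p k) * M k (p k)) =
          (\<Prod>i=0..<n. if i = k then euler (M i (p i)) + w (p i) * M i (p i) else M i (p i))"
        by (subst (2) prod.remove[of _ k]) (auto simp: mult_ac intro!: prod.cong)
    qed
    finally show ?thesis .
  qed
  have "euler (Determinant.det (Matrix.mat n n (\<lambda>(r, c). M r c))) +
      (\<Sum>c<n. w c) * Determinant.det (Matrix.mat n n (\<lambda>(r, c). M r c)) =
      (\<Sum>p\<in>?P. signof p * (euler (\<Prod>i=0..<n. M i (p i)) + (\<Sum>c<n. w c) * (\<Prod>i=0..<n. M i (p i))))"
    unfolding expand
    by (simp add: euler_sum euler_signof sum_distrib_left sum.distrib distrib_left mult.left_commute)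
  also have "\<dots> = (\<Sum>p\<in>?P. \<Sum>k<n. signof p *
      (\<Prod>i=0..<n. if i = k then euler (M i (p i)) + w (p i) * M i (p i) else M i (p i)))"
    by (intro sum.cong refl) (simp add: single sum_distrib_left)
  also have "\<dots> = (\<Sum>k<n. \<Sum>p\<in>?P. signof p *
      (\<Prod>i=0..<n. if i = k then euler (M i (p i)) + w (p i) * M i (p i) else M i (p i)))"
    by (rule sum.swap)
  finally show ?thesis unfolding expand .
qed

text \<open>As for classical Wronskians, differentiating any row but the last one repeats the next row.\<close>

lemma twisted_wronskian:
  assumes "cs \<noteq> []"
  shows "euler (wronskian cs) + (\<Sum>c\<leftarrow>cs. logistic_factor c) * wronskian cs =
    minor jet ([0..<length cs - 1] @ [length cs]) cs"
proof -
  let ?n = "length cs"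
  let ?M = "\<lambda>r c. jet r (cs ! c)"
  let ?R = "\<lambda>k. Determinant.det (Matrix.mat ?n ?n (\<lambda>(r, c). if r = k then jet (Suc r) (cs ! c) else jet r (cs ! c)))"
  have w: "wronskian cs = Determinant.det (Matrix.mat ?n ?n (\<lambda>(r, c). ?M r c))"
    unfolding wronskian_def minor_def
    by (intro arg_cong[of _ _ Determinant.det] eq_matI) auto
  have "(\<Sum>c\<leftarrow>cs. logistic_factor c) = (\<Sum>c<?n. logistic_factor (cs ! c))"
    by (simp add: sum_list_sum_nth atLeast0LessThan)
  then have "euler (wronskian cs) + (\<Sum>c\<leftarrow>cs. logistic_factor c) * wronskian cs = (\<Sum>k<?n. ?R k)"
    unfolding w by (simp only: euler_det jet_Suc twisted_def)
  also have "\<dots> = ?R (?n - 1)"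
  proof -
    have zero: "?R k = 0" if "Suc k < ?n" for k
      by (rule det_identical_rows[of _ ?n k "Suc k"]) (use that in \<open>auto intro!: eq_vecI\<close>)
    then have "(\<Sum>k<?n. ?R k) = (\<Sum>k\<in>{?n - 1}. ?R k)"
      using assms by (intro sum.mono_neutral_right) (auto intro!: zero)
    then show ?thesis by simp
  qed
  also have "\<dots> = minor jet ([0..<?n - 1] @ [?n]) cs"
    unfolding minor_def using assms
    by (intro arg_cong[of _ _ Determinant.det] eq_matI) (auto simp: nth_append)
  finally show ?thesis .
qed

text \<open>This is \<open>W(F, f\<^sub>a) W(F, f\<^sub>b)' - W(F, f\<^sub>a)' W(F, f\<^sub>b) = W(F) W(F, f\<^sub>a, f\<^sub>b)\<close> with the functions factored out; it
is the Desnanot-Jacobi identity because differentiating a Wronskian shifts its last row.\<close>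

lemma wronskian_identity:
  assumes nz: "wronskian cs \<noteq> 0"
  shows "wronskian (cs @ [a]) * twisted b (wronskian (cs @ [b])) -
         twisted a (wronskian (cs @ [a])) * wronskian (cs @ [b]) =
         wronskian cs * wronskian (cs @ [a, b])"
proof -
  let ?n = "length cs" and ?w = "\<Sum>c\<leftarrow>cs. logistic_factor c"
  have shift: "minor jet ([0..<?n] @ [Suc ?n]) (cs @ [c]) =
      twisted c (wronskian (cs @ [c])) + ?w * wronskian (cs @ [c])" for c
    using twisted_wronskian[of "cs @ [c]"] by (simp add: twisted_def algebra_simps)
  have "minor jet ([0..<?n] @ [?n]) (cs @ [a]) * minor jet ([0..<?n] @ [Suc ?n]) (cs @ [b]) -
        minor jet ([0..<?n] @ [Suc ?n]) (cs @ [a]) * minor jet ([0..<?n] @ [?n]) (cs @ [b]) =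
        minor jet [0..<?n] cs * minor jet ([0..<?n] @ [?n, Suc ?n]) (cs @ [a, b])"
    by (rule desnanot_jacobi) (use nz in \<open>auto simp: wronskian_def\<close>)
  then show ?thesis
    unfolding shift by (simp add: wronskian_def algebra_simps)
qed

lemma wronskian_Nil [simp]: "wronskian [] = 1"
  by (simp add: wronskian_def minor_def)

lemma wronskian_single [simp]: "wronskian [e] = 1"
  by (simp add: wronskian_def minor_def det_single)

lemma wronskian_repeated:
  assumes "\<not> distinct cs"
  shows "wronskian cs = 0"
proof -
  obtain i j where ij: "i < length cs" "j < length cs" "i \<noteq> j" "cs ! i = cs ! j"
    using assms by (auto simp: distinct_conv_nth)
  show ?thesis
    unfolding wronskian_def minor_def
    by (rule det_identical_columns[of _ "length cs" i j]) (use ij in \<open>auto intro!: eq_vecI\<close>)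
qed

lemma degree_twisted: "degree (twisted e p) \<le> Suc (degree p)"
proof -
  have "degree (euler p) \<le> Suc (degree p)"
  proof (cases "degree p = 0")
    case True
    then have "pderiv p = 0" by (simp add: pderiv_eq_0_iff)
    then show ?thesis by (simp add: euler_def)
  next
    case False
    have "degree (euler p) \<le> degree [:0, 1, -1 :: real:] + degree (pderiv p)"
      unfolding euler_def by (rule degree_mult_le)
    also have "\<dots> \<le> Suc (degree p)" using False by (simp add: degree_pderiv)
    finally show ?thesis .
  qed
  moreover have "degree (logistic_factor e * p) \<le> Suc (degree p)"
  proof -
    have "degree (logistic_factor e) \<le> 1" by (simp add: logistic_factor_def)
    then show ?thesis using degree_mult_le[of "logistic_factor e" p] by linarith
  qed
  ultimately show ?thesis unfolding twisted_def by (intro degree_add_le)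
qed

lemma degree_jet: "degree (jet r e) \<le> r"
  by (induction r) (auto simp: jet_Suc intro: order_trans[OF degree_twisted])

text \<open>Row \<open>r\<close> has entries of degree at most \<open>r\<close>, so each term of the Leibniz expansion has degree at most
\<open>0 + 1 + \<dots> + (n - 1)\<close>.\<close>

lemma degree_wronskian: "2 * degree (wronskian cs) \<le> length cs * (length cs - 1)"
proof -
  let ?n = "length cs"
  let ?A = "Matrix.mat ?n ?n (\<lambda>(r, c). jet ([0..<?n] ! r) (cs ! c))"
  have "degree (Determinant.det ?A) \<le> (\<Sum>i<?n. i)"
    unfolding det_def'[OF mat_carrier]
  proof (rule degree_sum_le)
    fix p assume "p \<in> {p. p permutes {0..<?n}}"
    then have p: "p i < ?n" if "i < ?n" for i using that by (simp add: permutes_nat_less)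
    have "degree (signof p * (\<Prod>i=0..<?n. ?A $$ (i, p i))) = degree (\<Prod>i=0..<?n. ?A $$ (i, p i))"
      by (auto simp: sign_def)
    also have "\<dots> \<le> (\<Sum>i=0..<?n. degree (?A $$ (i, p i)))"
      using degree_prod_sum_le[of "{0..<?n}" "\<lambda>i. ?A $$ (i, p i)"] by (simp add: comp_def)
    also have "\<dots> \<le> (\<Sum>i=0..<?n. i)" by (intro sum_mono) (auto simp: p degree_jet)
    finally show "degree (signof p * (\<Prod>i=0..<?n. ?A $$ (i, p i))) \<le> (\<Sum>i<?n. i)"
      by (simp add: atLeast0LessThan)
  qed (simp add: finite_permutations)
  then have "degree (wronskian cs) \<le> (\<Sum>i<?n. i)" by (simp add: wronskian_def minor_def)
  moreover have "2 * (\<Sum>i<m. i) = m * (m - 1)" for m :: nat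
  proof (induction m)
    case (Suc m)
    then show ?case by (cases m) (simp_all add: algebra_simps)
  qed simp
  ultimately show ?thesis by (metis mult_le_mono2)
qed

section \<open>Zeros of sums of two-sided power functions\<close>

definition bimonomial :: "exponents \<Rightarrow> real \<Rightarrow> real" where
  "bimonomial e x = x powr fst e * (1 - x) powr snd e"

lemma bimonomial_pos: "0 < x \<Longrightarrow> x < 1 \<Longrightarrow> bimonomial e x > 0"
  by (simp add: bimonomial_def)

lemma bimonomial_diff: "0 < x \<Longrightarrow> x < 1 \<Longrightarrow> bimonomial (e - c) x = bimonomial e x / bimonomial c x"
  by (simp add: bimonomial_def powr_diff)

lemma poly_twisted:
  "poly (twisted e p) x = x * (1 - x) * poly (pderiv p) x + (fst e - (fst e + snd e) * x) * poly p x"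
  by (simp add: twisted_def euler_def logistic_factor_def algebra_simps)

lemma has_derivative_bimonomial_poly:
  assumes x: "0 < x" "x < 1"
  shows "((\<lambda>x. bimonomial e x * poly p x) has_real_derivative
           bimonomial e x * poly (twisted e p) x / (x * (1 - x))) (at x)"
proof -
  have powr: "((\<lambda>x. x powr a) has_real_derivative x powr a * (a / x)) (at x)" if "x > 0" for a x :: real
    using has_real_derivative_powr[OF that, of a] that by (simp add: powr_diff mult.commute)
  have "((\<lambda>x. (1 - x) powr snd e) has_real_derivative
      ((1 - x) powr snd e * (snd e / (1 - x))) * (-1)) (at x)"
    by (rule DERIV_chain2[OF powr]) (use x in \<open>auto intro!: derivative_eq_intros\<close>)
  from DERIV_mult[OF DERIV_mult[OF powr[OF x(1), of "fst e"] this] poly_DERIV[of p x]]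
  show ?thesis
    unfolding bimonomial_def poly_twisted
    by (rule DERIV_cong) (use x in \<open>simp add: field_simps\<close>)
qed

text \<open>Up to the positive factor coming from \<open>cs\<close>, this is the Wronskian of the functions listed in \<open>cs\<close> and
the function \<open>\<Sum>e\<in>E. a e f\<^sub>e\<close>.\<close>

definition wronskian_sum :: "exponents set \<Rightarrow> (exponents \<Rightarrow> real) \<Rightarrow> exponents list \<Rightarrow> real \<Rightarrow> real" where
  "wronskian_sum E a cs x = (\<Sum>e\<in>E. a e * (bimonomial e x * poly (wronskian (cs @ [e])) x))"

text \<open>Dividing the sum by \<open>f\<^sub>c\<close> and by the polynomial \<open>wronskian (cs @ [c])\<close> and differentiating yields, by
\<open>wronskian_identity\<close>, the sum for the longer list, up to the factor \<open>wronskian cs\<close> and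
a positive factor.\<close>

lemma wronskian_quotient_step:
  assumes "wronskian cs \<noteq> 0" "wronskian (cs @ [c]) \<noteq> 0"
    and sc: "sign_changes_le {0<..<1} (wronskian_sum E a (cs @ [c])) n"
  shows "sign_changes_le {0<..<1} (wronskian_sum E a cs)
           (Suc (degree (wronskian (cs @ [c])) + (degree (wronskian cs) + n)))"
proof -
  let ?D = "{0<..<1::real}" and ?P = "wronskian (cs @ [c])" and ?Q = "\<lambda>e. wronskian (cs @ [e])"
  define H where "H x = (\<Sum>e\<in>E. a e * (bimonomial (e - c) x * poly (?Q e) x))" for x
  define H' where "H' x = (\<Sum>e\<in>E. a e * (bimonomial (e - c) x * poly (twisted (e - c) (?Q e)) x / (x * (1 - x))))" for x
  define w where "w x = 1 / (x * (1 - x) * bimonomial c x)" for x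
  have deriv: "(H has_real_derivative H' x) (at x)" if "x \<in> ?D" for x
    unfolding H_def H'_def using that
    by (intro DERIV_sum DERIV_cmult has_derivative_bimonomial_poly) auto
  have N: "w x * (poly (wronskian cs) x * wronskian_sum E a (cs @ [c]) x) =
      poly ?P x * H' x - poly (pderiv ?P) x * H x" if x: "x \<in> ?D" for x
  proof -
    have pos: "x > 0" "1 - x > 0" "bimonomial c x > 0" using x bimonomial_pos by auto
    have key: "w x * (poly (wronskian cs) x * (bimonomial e x * poly (wronskian (cs @ [c, e])) x)) =
        poly ?P x * (bimonomial (e - c) x * poly (twisted (e - c) (?Q e)) x / (x * (1 - x))) -
        poly (pderiv ?P) x * (bimonomial (e - c) x * poly (?Q e) x)" for e
    proof -
      have "poly (wronskian cs * wronskian (cs @ [c, e])) x =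
          poly (?P * twisted e (?Q e) - twisted c ?P * ?Q e) x"
        using wronskian_identity[OF assms(1), of c e] by simp
      also have "\<dots> = poly ?P x * poly (twisted (e - c) (?Q e)) x -
          x * (1 - x) * poly (pderiv ?P) x * poly (?Q e) x"
        by (simp add: poly_twisted algebra_simps)
      finally have id: "poly (wronskian cs) x * poly (wronskian (cs @ [c, e])) x =
          poly ?P x * poly (twisted (e - c) (?Q e)) x -
          x * (1 - x) * poly (pderiv ?P) x * poly (?Q e) x" by simp
      have "w x * (poly (wronskian cs) x * (bimonomial e x * poly (wronskian (cs @ [c, e])) x)) =
          (bimonomial e x / bimonomial c x) *
          ((poly (wronskian cs) x * poly (wronskian (cs @ [c, e])) x) / (x * (1 - x)))"
        by (simp add: w_def mult_ac)
      also have "\<dots> = (bimonomial e x / bimonomial c x) *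
          (poly ?P x * poly (twisted (e - c) (?Q e)) x / (x * (1 - x)) -
           poly (pderiv ?P) x * poly (?Q e) x)"
        unfolding id using pos by (simp add: diff_divide_distrib)
      finally show ?thesis
        using x by (simp add: bimonomial_diff algebra_simps)
    qed
    show ?thesis
      unfolding wronskian_sum_def H_def H'_def sum_distrib_left sum_subtractf[symmetric]
    proof (rule sum.cong[OF refl])
      fix e
      show "w x * (poly (wronskian cs) x * (a e * (bimonomial e x * poly (wronskian ((cs @ [c]) @ [e])) x))) =
          poly ?P x * (a e * (bimonomial (e - c) x * poly (twisted (e - c) (?Q e)) x / (x * (1 - x)))) -
          poly (pderiv ?P) x * (a e * (bimonomial (e - c) x * poly (?Q e) x))"
        using arg_cong[OF key[of e], of "\<lambda>y. a e * y"] by (simp add: algebra_simps)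
    qed
  qed
  have "sign_changes_le ?D (poly (wronskian cs)) (degree (wronskian cs))"
    by (rule sign_changes_le_poly) (auto simp: is_interval_oo)
  from sign_changes_le_mult[OF this sc]
  have "sign_changes_le ?D (\<lambda>x. w x * (poly (wronskian cs) x * wronskian_sum E a (cs @ [c]) x))
      (degree (wronskian cs) + n)"
    by (rule sign_changes_le_mult_pos[rotated]) (auto simp: w_def bimonomial_pos)
  from sign_changes_le_cong[OF N this]
  have "sign_changes_le ?D H (Suc (degree ?P + (degree (wronskian cs) + n)))"
    by (intro sign_changes_le_quotient[OF _ _ deriv assms(2)]) (auto simp: is_interval_oo)
  from sign_changes_le_mult_pos[OF _ this, of "bimonomial c"]
  have "sign_changes_le ?D (\<lambda>x. bimonomial c x * H x) (Suc (degree ?P + (degree (wronskian cs) + n)))"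
    by (auto simp: bimonomial_pos)
  then show ?thesis
  proof (rule sign_changes_le_cong[rotated])
    fix x :: real assume x: "x \<in> ?D"
    then have "bimonomial c x \<noteq> 0" using bimonomial_pos[of x c] by auto
    then show "bimonomial c x * H x = wronskian_sum E a cs x"
      using x unfolding H_def wronskian_sum_def sum_distrib_left
      by (intro sum.cong refl) (simp add: bimonomial_diff)
  qed
qed

text \<open>The list is extended as long as some extension has a nonzero Wronskian. If none has, then every
summand vanishes. If only one function is left, then the summands of the listed functions vanish
and the remaining one changes sign at most as often as its Wronskian. Extending a list of length \<open>j\<close> costs
\<open>1 + (j + 1) j / 2 + j (j - 1) / 2 = 1 + j\<^sup>2\<close>.\<close>

lemma sign_changes_wronskian_sum:
  assumes "finite E" "set cs \<subseteq> E" "wronskian cs \<noteq> 0" "length cs < card E"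
  shows "sign_changes_le {0<..<1} (wronskian_sum E a cs)
           ((\<Sum>j=length cs..<card E - 1. Suc (j * j)) + card E * (card E - 1) div 2)"
  using assms(2-4)
proof (induction "card E - length cs" arbitrary: cs rule: less_induct)
  case less
  have dist: "distinct cs" using less.prems wronskian_repeated by blast
  then have card_cs: "card (set cs) = length cs" by (rule distinct_card)
  have repeat: "wronskian (cs @ [e]) = 0" if "e \<in> set cs" for e
    using that wronskian_repeated[of "cs @ [e]"] by auto
  consider (final) "Suc (length cs) = card E"
    | (stuck) "\<And>e. e \<in> E \<Longrightarrow> wronskian (cs @ [e]) = 0"
    | (step) c where "c \<in> E" "wronskian (cs @ [c]) \<noteq> 0" "Suc (length cs) < card E"
    using less.prems(3) by (meson Suc_lessI)
  then show ?case
  proof cases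
    case final
    have "card (E - set cs) = 1"
      using card_Diff_subset[of "set cs" E] less.prems(1) card_cs final by simp
    then obtain e where e: "E - set cs = {e}" by (auto simp: card_1_singleton_iff)
    let ?p = "Polynomial.smult (a e) (wronskian (cs @ [e]))"
    have eq: "wronskian_sum E a cs = (\<lambda>x. bimonomial e x * poly ?p x)"
    proof
      fix x
      have "wronskian_sum E a cs x = (\<Sum>e\<in>E - set cs. a e * (bimonomial e x * poly (wronskian (cs @ [e])) x))"
        unfolding wronskian_sum_def using assms(1) less.prems(1) repeat
        by (intro sum.mono_neutral_right) auto
      then show "wronskian_sum E a cs x = bimonomial e x * poly ?p x" by (simp add: e)
    qed
    have "sign_changes_le {0<..<1} (wronskian_sum E a cs) (degree ?p)"
      unfolding eq
      by (intro sign_changes_le_mult_pos sign_changes_le_poly) (auto simp: is_interval_oo bimonomial_pos)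
    moreover have "degree ?p \<le> card E * (card E - 1) div 2"
    proof -
      have "length (cs @ [e]) = card E" using final by simp
      then have "2 * degree (wronskian (cs @ [e])) \<le> card E * (card E - 1)"
        using degree_wronskian[of "cs @ [e]"] by metis
      then show ?thesis using degree_smult_le[of "a e" "wronskian (cs @ [e])"] by linarith
    qed
    ultimately show ?thesis by (auto elim: sign_changes_le_mono)
  next
    case stuck
    then have "wronskian_sum E a cs x = 0" for x by (simp add: wronskian_sum_def)
    then have "sign_changes_le {0<..<1} (wronskian_sum E a cs) 0"
      by (intro sign_changes_le_0) simp
    then show ?thesis by (rule sign_changes_le_mono) simp
  next
    case step
    let ?n = "(\<Sum>j=Suc (length cs)..<card E - 1. Suc (j * j)) + card E * (card E - 1) div 2"
    have "sign_changes_le {0<..<1} (wronskian_sum E a (cs @ [c])) ?n"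
      using less.hyps[of "cs @ [c]"] less.prems step by auto
    from wronskian_quotient_step[OF less.prems(2) step(2) this]
    show ?thesis
    proof (rule sign_changes_le_mono)
      have "2 * (degree (wronskian (cs @ [c])) + degree (wronskian cs)) \<le> 2 * (length cs * length cs)"
        using degree_wronskian[of "cs @ [c]"] degree_wronskian[of cs]
        by (cases "length cs") (simp_all add: algebra_simps)
      then have "degree (wronskian (cs @ [c])) + degree (wronskian cs) \<le> length cs * length cs" by simp
      moreover have "(\<Sum>j=length cs..<card E - 1. Suc (j * j)) =
          Suc (length cs * length cs) + (\<Sum>j=Suc (length cs)..<card E - 1. Suc (j * j))"
        using step(3) by (intro sum.atLeast_Suc_lessThan) simp
      ultimately show "Suc (degree (wronskian (cs @ [c])) + (degree (wronskian cs) + ?n)) \<le>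
          (\<Sum>j=length cs..<card E - 1. Suc (j * j)) + card E * (card E - 1) div 2"
        by simp
    qed
  qed
qed

text \<open>The pair \<open>0\<close> stands for the constant function \<open>1\<close>. Starting with it makes the first Wronskian sum a
positive multiple of the derivative, so that the first step can count zeros instead of sign changes.\<close>

theorem card_zeros_bimonomial_sum:
  assumes "finite E" "0 \<in> E" "2 \<le> card E"
    and fin: "finite {x \<in> {0<..<1}. (\<Sum>e\<in>E. a e * bimonomial e x) = 0}"
  shows "card {x \<in> {0<..<1}. (\<Sum>e\<in>E. a e * bimonomial e x) = 0} \<le>
           Suc ((\<Sum>j=1..<card E - 1. Suc (j * j)) + card E * (card E - 1) div 2)"
proof -
  let ?D = "{0<..<1::real}"
  define f' where "f' x = (\<Sum>e\<in>E. a e * (bimonomial e x * poly (twisted e 1) x / (x * (1 - x))))" for x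
  have deriv: "((\<lambda>x. \<Sum>e\<in>E. a e * bimonomial e x) has_real_derivative f' x) (at x)" if "x \<in> ?D" for x
    unfolding f'_def using has_derivative_bimonomial_poly[of x _ 1] that
    by (intro DERIV_sum DERIV_cmult) auto
  have tw: "twisted e 1 = wronskian [0, e]" for e
  proof -
    have "twisted 0 1 = 0" by (simp add: twisted_def euler_def logistic_factor_def)
    then show ?thesis using wronskian_identity[of "[]" 0 e] by simp
  qed
  have "sign_changes_le ?D (wronskian_sum E a [0])
      ((\<Sum>j=1..<card E - 1. Suc (j * j)) + card E * (card E - 1) div 2)"
    using sign_changes_wronskian_sum[of E "[0]" a] assms by simp
  then have "sign_changes_le ?D (\<lambda>x. 1 / (x * (1 - x)) * wronskian_sum E a [0] x)
      ((\<Sum>j=1..<card E - 1. Suc (j * j)) + card E * (card E - 1) div 2)"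
    by (rule sign_changes_le_mult_pos[rotated]) auto
  moreover have "1 / (x * (1 - x)) * wronskian_sum E a [0] x = f' x" for x
    unfolding f'_def wronskian_sum_def tw sum_distrib_left
    by (intro sum.cong refl) simp
  ultimately have "sign_changes_le ?D f' ((\<Sum>j=1..<card E - 1. Suc (j * j)) + card E * (card E - 1) div 2)"
    by simp
  then show ?thesis
    by (intro card_zeros_le_sign_changes_deriv[OF _ deriv fin]) (auto simp: is_interval_oo)
qed

section \<open>Monomial coordinates on the positive quadrant\<close>

definition cross2 :: "real ^ 2 \<Rightarrow> real ^ 2 \<Rightarrow> real" where
  "cross2 e f = e $ 1 * f $ 2 - e $ 2 * f $ 1"

lemma monomial_exp:
  "x \<in> positive_orthant \<Longrightarrow> monomial x e = exp (e $ 1 * ln (x $ 1) + e $ 2 * ln (x $ 2))"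
  by (simp add: monomial_def positive_orthant_def powr_def exp_add)

lemma monomial_pos: "x \<in> positive_orthant \<Longrightarrow> monomial x e > 0"
  by (simp add: monomial_exp)

lemma monomial_linear_combination:
  "x \<in> positive_orthant \<Longrightarrow>
    monomial x (p *\<^sub>R e + q *\<^sub>R f) = monomial x e powr p * monomial x f powr q"
  by (simp add: monomial_exp powr_def exp_add[symmetric] algebra_simps)

lemma monomial_scaleR: "x \<in> positive_orthant \<Longrightarrow> monomial x (r *\<^sub>R e) = monomial x e powr r"
  by (simp add: monomial_exp powr_def algebra_simps)

lemma linear_combination_exists:
  assumes "cross2 e f \<noteq> 0"
  obtains p q where "b = p *\<^sub>R e + q *\<^sub>R f"
proof
  \<comment> \<open>Cramer's rule\<close>
  have "cross2 e f * b $ 1 = cross2 b f * e $ 1 + cross2 e b * f $ 1"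
    and "cross2 e f * b $ 2 = cross2 b f * e $ 2 + cross2 e b * f $ 2"
    by (simp_all add: cross2_def algebra_simps)
  then show "b = (cross2 b f / cross2 e f) *\<^sub>R e + (cross2 e b / cross2 e f) *\<^sub>R f"
    unfolding Finite_Cartesian_Product.vec_eq_iff forall_2 using assms
    by (simp add: add_divide_distrib[symmetric] eq_divide_eq mult.commute)
qed

lemma bij_betw_monomials:
  assumes "cross2 e f \<noteq> 0"
  shows "bij_betw (\<lambda>x. (monomial x e, monomial x f)) positive_orthant ({0<..} \<times> {0<..})"
proof (rule bij_betwI')
  fix x y assume xy: "x \<in> positive_orthant" "y \<in> positive_orthant"
  show "(monomial x e, monomial x f) = (monomial y e, monomial y f) \<longleftrightarrow> x = y"
  proof
    assume eq: "(monomial x e, monomial x f) = (monomial y e, monomial y f)"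
    have "monomial x g = monomial y g" for g
    proof -
      obtain p q where "g = p *\<^sub>R e + q *\<^sub>R f" using linear_combination_exists[OF assms] .
      then show ?thesis using eq xy by (simp add: monomial_linear_combination)
    qed
    from this[of "axis 1 1"] this[of "axis 2 1"] xy show "x = y"
      by (simp add: monomial_def axis_def positive_orthant_def Finite_Cartesian_Product.vec_eq_iff forall_2)
  qed simp
next
  fix x assume "x \<in> positive_orthant"
  then show "(monomial x e, monomial x f) \<in> {0<..} \<times> {0<..}" by (simp add: monomial_pos)
next
  fix uv :: "real \<times> real" assume uv: "uv \<in> {0<..} \<times> {0<..}"
  obtain u v where uv': "uv = (u, v)" "u > 0" "v > 0" using uv by auto
  \<comment> \<open>Cramer's rule for the linear equations that the two conditions impose on the logarithms\<close>
  define x :: "real ^ 2" where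
    "x = vector [exp ((ln u * f $ 2 - e $ 2 * ln v) / cross2 e f),
                 exp ((e $ 1 * ln v - f $ 1 * ln u) / cross2 e f)]"
  have x: "x \<in> positive_orthant" by (simp add: x_def positive_orthant_def)
  have "e $ 1 * (ln u * f $ 2 - e $ 2 * ln v) + e $ 2 * (e $ 1 * ln v - f $ 1 * ln u) =
      cross2 e f * ln u"
    and "f $ 1 * (ln u * f $ 2 - e $ 2 * ln v) + f $ 2 * (e $ 1 * ln v - f $ 1 * ln u) =
      cross2 e f * ln v"
    by (simp_all add: cross2_def algebra_simps)
  then have "e $ 1 * ln (x $ 1) + e $ 2 * ln (x $ 2) = ln u"
    and "f $ 1 * ln (x $ 1) + f $ 2 * ln (x $ 2) = ln v"
    using assms by (simp_all add: x_def add_divide_distrib[symmetric])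
  then have "monomial x e = u" "monomial x f = v"
    using uv' x by (simp_all add: monomial_exp)
  then show "\<exists>x\<in>positive_orthant. uv = (monomial x e, monomial x f)"
    using x uv' by auto
qed

lemma monomials_eq_imp_eq:
  assumes "cross2 e f \<noteq> 0" "x \<in> positive_orthant" "y \<in> positive_orthant"
    "monomial x e = monomial y e" "monomial x f = monomial y f"
  shows "x = y"
  using bij_betw_imp_inj_on[OF bij_betw_monomials[OF assms(1)]] assms(2-)
  by (simp add: inj_on_def)

lemma monomials_surj:
  assumes "cross2 e f \<noteq> 0" "u > 0" "v > 0"
  obtains x where "x \<in> positive_orthant" "monomial x e = u" "monomial x f = v"
proof -
  have "(u, v) \<in> (\<lambda>x. (monomial x e, monomial x f)) ` positive_orthant"
    unfolding bij_betw_imp_surj_on[OF bij_betw_monomials[OF assms(1)]] using assms by simp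
  then show ?thesis using that by auto
qed

lemma parallel_if_cross2_eq_0:
  assumes "e \<noteq> 0" "cross2 e f = 0"
  obtains l where "f = l *\<^sub>R e"
proof -
  have "e $ 1 \<noteq> 0 \<or> e $ 2 \<noteq> 0" using assms(1) by (auto simp: Finite_Cartesian_Product.vec_eq_iff forall_2)
  then show ?thesis
  proof
    assume "e $ 1 \<noteq> 0"
    then have "f = (f $ 1 / e $ 1) *\<^sub>R e"
      using assms(2) by (simp add: Finite_Cartesian_Product.vec_eq_iff forall_2 cross2_def field_simps)
    then show ?thesis by (rule that)
  next
    assume "e $ 2 \<noteq> 0"
    then have "f = (f $ 2 / e $ 2) *\<^sub>R e"
      using assms(2) by (simp add: Finite_Cartesian_Product.vec_eq_iff forall_2 cross2_def field_simps)
    then show ?thesis by (rule that)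
  qed
qed

section \<open>Exponential sums and trinomials in one variable\<close>

text \<open>Factoring out one exponential and differentiating removes one summand.\<close>

lemma sign_changes_exp_sum:
  assumes "finite I"
  shows "sign_changes_le UNIV (\<lambda>s. \<Sum>i\<in>I. a i * exp (q i * s)) (card I - 1)"
  using assms
proof (induction I arbitrary: a q rule: finite_induct)
  case empty
  show ?case by (intro sign_changes_le_mono[OF sign_changes_le_0]) simp_all
next
  case (insert i I)
  show ?case
  proof (cases "I = {}")
    case True
    have "sign_changes_le UNIV (\<lambda>s. a i * exp (q i * s)) 0"
      by (rule sign_changes_le_0) (simp add: zero_le_mult_iff mult_le_0_iff linear)
    then show ?thesis using True by simp
  next
    case False
    have "sign_changes_le UNIV (\<lambda>s. \<Sum>j\<in>I. (a j * (q j - q i)) * exp ((q j - q i) * s)) (card I - 1)"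
      by (rule insert.IH)
    then have "sign_changes_le UNIV (\<lambda>s. a i + (\<Sum>j\<in>I. a j * exp ((q j - q i) * s))) (Suc (card I - 1))"
      by (rule sign_changes_le_deriv[rotated -1])
         (auto intro!: derivative_eq_intros sum.cong)
    then have "sign_changes_le UNIV (\<lambda>s. exp (q i * s) * (a i + (\<Sum>j\<in>I. a j * exp ((q j - q i) * s))))
        (Suc (card I - 1))"
      by (rule sign_changes_le_mult_pos[rotated]) simp
    moreover have "exp (q i * s) * (a i + (\<Sum>j\<in>I. a j * exp ((q j - q i) * s))) =
        (\<Sum>j\<in>insert i I. a j * exp (q j * s))" for s
      using insert.hyps
      by (simp add: distrib_left sum_distrib_left mult.left_commute exp_add[symmetric] left_diff_distrib)
    moreover have "Suc (card I - 1) = card (insert i I) - 1"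
      using insert.hyps False by (simp add: card_gt_0_iff)
    ultimately show ?thesis by simp
  qed
qed

lemma card_zeros_exp_sum:
  assumes "finite I" and "finite {s. (\<Sum>i\<in>I. a i * exp (q i * s)) = c}"
  shows "card {s. (\<Sum>i\<in>I. a i * exp (q i * s)) = (c::real)} \<le> Suc (card I - 1)"
proof -
  have "((\<lambda>s. (\<Sum>i\<in>I. a i * exp (q i * s)) - c) has_real_derivative
      (\<Sum>i\<in>I. (a i * q i) * exp (q i * s))) (at s)" for s
    by (auto intro!: derivative_eq_intros sum.cong)
  from card_zeros_le_sign_changes_deriv[OF is_interval_univ this _ sign_changes_exp_sum[OF assms(1)]]
  show ?thesis using assms(2) by simp
qed

text \<open>Three roots would give two zeros of the derivative \<open>c + d l v\<^sup>l\<^sup>-\<^sup>1\<close>, which has at most one since \<open>l \<noteq> 1\<close>.\<close>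

lemma card_trinomial_roots:
  fixes c d l :: real
  assumes "c > 0" "d > 0" "l \<noteq> 0" "l \<noteq> 1" and "finite V"
    and V: "\<And>v. v \<in> V \<Longrightarrow> v > 0 \<and> c * v + d * v powr l = 1"
  shows "card V \<le> 2"
proof (rule ccontr)
  assume "\<not> card V \<le> 2"
  define xs where "xs = sorted_list_of_set V"
  have xs: "set xs = V" "sorted_wrt (<) xs" "length xs \<ge> 3"
    using assms(5) \<open>\<not> card V \<le> 2\<close> by (simp_all add: xs_def)
  define f where "f = (\<lambda>v. c * v + d * v powr l)"
  define f' where "f' = (\<lambda>v. c + d * (l * v powr (l - 1)))"
  have deriv: "(f has_real_derivative f' v) (at v)" if "v > 0" for v
    unfolding f_def f'_def using that
    by (auto intro!: derivative_eq_intros has_real_derivative_powr)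
  have rolle: "\<exists>z. v < z \<and> z < w \<and> f' z = 0" if "v \<in> V" "w \<in> V" "v < w" for v w
  proof -
    have "\<exists>z. v < z \<and> z < w \<and> f w - f v = (w - v) * f' z"
      using V[OF that(1)] by (intro MVT2 that deriv) auto
    then show ?thesis using V that by (auto simp: f_def)
  qed
  have "0 < length xs" "1 < length xs" "2 < length xs" using xs(3) by linarith+
  then have mem: "xs ! 0 \<in> V" "xs ! 1 \<in> V" "xs ! 2 \<in> V" using nth_mem xs(1) by blast+
  have "xs ! 0 < xs ! 1" "xs ! 1 < xs ! 2"
    using sorted_wrt_nth_less[OF xs(2), of 0 1] sorted_wrt_nth_less[OF xs(2), of 1 2] xs(3) by simp_all
  with rolle[OF mem(1,2)] rolle[OF mem(2,3)]
  obtain y z where yz: "xs ! 0 < y" "y < xs ! 1" "f' y = 0" "xs ! 1 < z" "f' z = 0"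
    by blast
  then have pos: "y > 0" "z > 0" using V[OF mem(1)] by auto
  have "d * (l * y powr (l - 1)) = d * (l * z powr (l - 1))"
    using yz(3,5) unfolding f'_def by linarith
  then have "y powr (l - 1) = z powr (l - 1)" using assms by simp
  then have "(l - 1) * ln y = (l - 1) * ln z" using pos by (simp add: powr_def)
  then have "y = z" using assms pos by simp
  then show False using yz by simp
qed

section \<open>The two types of systems\<close>

text \<open>If the two exponents of the trinomial are independent, then \<open>u = k x\<^sup>e\<close> is a coordinate on the curve cut
out by the trinomial. It ranges over \<open>(0, 1)\<close>, and \<open>l x\<^sup>f = 1 - u\<close>, so every monomial becomes a
multiple of some \<open>u\<^sup>\<alpha> (1 - u)\<^sup>\<beta>\<close>.\<close>

lemma card_solutions_independent:
  fixes b :: "nat \<Rightarrow> real ^ 2" and d :: "nat \<Rightarrow> real"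
  assumes "finite I" "I \<noteq> {}" "inj_on b I" "0 \<notin> b ` I"
    and indep: "cross2 e f \<noteq> 0" and pos: "k > 0" "l > 0"
    and S: "S = {x \<in> positive_orthant. k * monomial x e + l * monomial x f = 1 \<and>
              (\<Sum>i\<in>I. d i * monomial x (b i)) = 1}"
    and "finite S"
  shows "card S \<le> Suc ((\<Sum>j=1..<card I. Suc (j * j)) + Suc (card I) * card I div 2)"
proof -
  have "\<exists>g. \<forall>i. b i = fst (g i) *\<^sub>R e + snd (g i) *\<^sub>R f"
    using linear_combination_exists[OF indep] by (intro choice) (metis fst_conv snd_conv)
  then obtain g :: "nat \<Rightarrow> real \<times> real" where g: "\<And>i. b i = fst (g i) *\<^sub>R e + snd (g i) *\<^sub>R f"
    by blast
  have inj: "inj_on g I" using assms(3) by (auto simp: inj_on_def g)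
  have nz: "0 \<notin> g ` I"
  proof
    assume "0 \<in> g ` I"
    then obtain i where "i \<in> I" "g i = 0" by auto
    then have "b i = 0" by (simp add: g)
    then show False using \<open>i \<in> I\<close> assms(4) by (metis image_eqI)
  qed
  \<comment> \<open>The constant \<open>-1\<close> of the equation is the term with exponent pair \<open>0\<close>; the powers of \<open>1 / k\<close> and
    \<open>1 / l\<close> come from \<open>x\<^sup>e = u / k\<close> and \<open>x\<^sup>f = (1 - u) / l\<close>.\<close>
  define E where "E = insert 0 (g ` I)"
  define h where "h = (\<lambda>i. d i * ((1 / k) powr fst (g i) * (1 / l) powr snd (g i)))"
  define a where "a c = (if c = 0 then -1 else h (inv_into I g c))" for c
  define u where "u x = k * monomial x e" for x
  let ?Z = "{y \<in> {0<..<1}. (\<Sum>c\<in>E. a c * bimonomial c y) = 0}"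
  have cardE: "card E = Suc (card I)"
    using assms(1) nz inj by (simp add: E_def card_image)
  have sum_E: "(\<Sum>c\<in>E. a c * bimonomial c y) = (\<Sum>i\<in>I. h i * bimonomial (g i) y) - 1"
    if "0 < y" "y < 1" for y
  proof -
    have "(\<Sum>c\<in>g ` I. a c * bimonomial c y) = (\<Sum>i\<in>I. h i * bimonomial (g i) y)"
      using inj nz by (subst sum.reindex) (auto simp: a_def intro!: sum.cong)
    moreover have "a 0 * bimonomial 0 y = -1" using that by (simp add: a_def bimonomial_def)
    ultimately show ?thesis using assms(1) nz by (simp add: E_def)
  qed
  have sum_I: "(\<Sum>i\<in>I. d i * monomial x (b i)) = (\<Sum>i\<in>I. h i * bimonomial (g i) y)"
    if "x \<in> positive_orthant" "k * monomial x e = y" "l * monomial x f = 1 - y" for x y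
  proof (intro sum.cong refl)
    fix i
    have "monomial x e = 1 / k * y" "monomial x f = 1 / l * (1 - y)"
      using that(2,3) pos by (simp_all add: field_simps)
    moreover have "y > 0" "1 - y > 0"
      using that pos monomial_pos[OF that(1)] by (metis mult_pos_pos)+
    ultimately show "d i * monomial x (b i) = h i * bimonomial (g i) y"
      using pos unfolding g[of i] monomial_linear_combination[OF that(1)]
      by (simp add: h_def bimonomial_def powr_mult powr_divide)
  qed
  have "bij_betw u S ?Z"
  proof (rule bij_betwI')
    fix x y assume xy: "x \<in> S" "y \<in> S"
    show "u x = u y \<longleftrightarrow> x = y"
    proof
      assume eq: "u x = u y"
      then have "monomial x e = monomial y e" using pos by (simp add: u_def)
      moreover have "monomial x f = monomial y f"
      proof -
        have "k * monomial x e + l * monomial x f = 1" "k * monomial y e + l * monomial y f = 1"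
          using xy by (simp_all add: S)
        then have "l * monomial x f = l * monomial y f" using eq unfolding u_def by linarith
        then show ?thesis using pos by simp
      qed
      ultimately show "x = y"
        using monomials_eq_imp_eq[OF indep] xy by (simp add: S)
    qed simp
  next
    fix x assume "x \<in> S"
    then have x: "x \<in> positive_orthant" "k * monomial x e + l * monomial x f = 1"
        "(\<Sum>i\<in>I. d i * monomial x (b i)) = 1" by (auto simp: S)
    have "u x > 0" "l * monomial x f > 0" using pos x(1) by (simp_all add: u_def monomial_pos)
    moreover have "l * monomial x f = 1 - u x" using x(2) by (simp add: u_def)
    ultimately show "u x \<in> ?Z"
      using sum_I[OF x(1), of "u x"] x(3) by (simp add: sum_E u_def[symmetric])
  next
    fix y assume y: "y \<in> ?Z"
    then have "y / k > 0" "(1 - y) / l > 0" using pos by simp_all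
    then obtain x where x: "x \<in> positive_orthant" "monomial x e = y / k" "monomial x f = (1 - y) / l"
      by (rule monomials_surj[OF indep])
    then have *: "k * monomial x e = y" "l * monomial x f = 1 - y" using pos by simp_all
    then have "x \<in> S" using sum_I[OF x(1) *] sum_E[of y] y x(1) * by (simp add: S)
    moreover have "y = u x" using * by (simp add: u_def)
    ultimately show "\<exists>x\<in>S. y = u x" by blast
  qed
  from bij_betw_same_card[OF this] bij_betw_finite[OF this] \<open>finite S\<close>
  have "card S = card ?Z" "finite ?Z" by simp_all
  moreover have "2 \<le> card E" using cardE assms(1,2) by (simp add: Suc_le_eq card_gt_0_iff)
  moreover have "finite E" "0 \<in> E" using assms(1) by (simp_all add: E_def)
  ultimately show ?thesis
    using card_zeros_bimonomial_sum[of E a] by (simp add: cardE)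
qed

text \<open>If the two exponents are parallel, then the trinomial only involves \<open>v = x\<^sup>e\<close>, which has at most two
possible values. For each of them the other equation is an exponential sum in the logarithm of a complementary
monomial, here the one whose exponent \<open>n\<close> is orthogonal to \<open>e\<close>.\<close>

lemma card_solutions_parallel:
  fixes b :: "nat \<Rightarrow> real ^ 2" and d :: "nat \<Rightarrow> real"
  assumes "finite I" "I \<noteq> {}" "e \<noteq> 0" "f \<noteq> 0" "e \<noteq> f"
    and parallel: "cross2 e f = 0" and pos: "k > 0" "l > 0"
    and S: "S = {x \<in> positive_orthant. k * monomial x e + l * monomial x f = 1 \<and>
              (\<Sum>i\<in>I. d i * monomial x (b i)) = 1}"
    and "finite S"
  shows "card S \<le> 2 * card I"
proof -
  obtain r where f: "f = r *\<^sub>R e" using parallel_if_cross2_eq_0 assms(3) parallel by blast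
  have mono_f: "monomial x f = monomial x e powr r" if "x \<in> positive_orthant" for x
    using that by (simp add: f monomial_scaleR)
  have r: "r \<noteq> 0" "r \<noteq> 1" using f assms(4,5) by auto
  define n :: "real ^ 2" where "n = vector [- e $ 2, e $ 1]"
  have "e $ 1 \<noteq> 0 \<or> e $ 2 \<noteq> 0" using assms(3) by (auto simp: Finite_Cartesian_Product.vec_eq_iff forall_2)
  then have indep: "cross2 e n \<noteq> 0" by (auto simp: cross2_def n_def sum_squares_eq_zero_iff)
  have "\<exists>g. \<forall>i. b i = fst (g i) *\<^sub>R e + snd (g i) *\<^sub>R n"
    using linear_combination_exists[OF indep] by (intro choice) (metis fst_conv snd_conv)
  then obtain g :: "nat \<Rightarrow> real \<times> real" where g: "\<And>i. b i = fst (g i) *\<^sub>R e + snd (g i) *\<^sub>R n"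
    by blast
  define V where "V = (\<lambda>x. monomial x e) ` S"
  have finV: "finite V" using \<open>finite S\<close> by (simp add: V_def)
  have cardV: "card V \<le> 2"
  proof (rule card_trinomial_roots[OF pos r finV])
    fix v assume "v \<in> V"
    then obtain x where x: "x \<in> S" "v = monomial x e" by (auto simp: V_def)
    then show "v > 0 \<and> k * v + l * v powr r = 1"
      using monomial_pos[of x e] mono_f[of x] by (simp add: S)
  qed
  have fibre: "card {x \<in> S. monomial x e = v} \<le> card I" if vV: "v \<in> V" for v
  proof -
    obtain x0 where x0: "x0 \<in> S" "v = monomial x0 e" using vV by (auto simp: V_def)
    then have v: "v > 0" "k * v + l * v powr r = 1"
      using monomial_pos[of x0 e] mono_f[of x0] by (simp_all add: S)
    define a where "a i = d i * v powr fst (g i)" for i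
    let ?Z = "{s. (\<Sum>i\<in>I. a i * exp (snd (g i) * s)) = 1}"
    have sum_I: "(\<Sum>i\<in>I. d i * monomial x (b i)) = (\<Sum>i\<in>I. a i * exp (snd (g i) * s))"
      if "x \<in> positive_orthant" "monomial x e = v" "monomial x n = exp s" for x s
      using that by (intro sum.cong refl) (simp add: g monomial_linear_combination a_def powr_def)
    have "bij_betw (\<lambda>x. ln (monomial x n)) {x \<in> S. monomial x e = v} ?Z"
    proof (rule bij_betwI')
      fix x y assume xy: "x \<in> {x \<in> S. monomial x e = v}" "y \<in> {x \<in> S. monomial x e = v}"
      then have "x \<in> positive_orthant" "y \<in> positive_orthant" by (auto simp: S)
      then show "ln (monomial x n) = ln (monomial y n) \<longleftrightarrow> x = y"
        using monomials_eq_imp_eq[OF indep, of x y] xy by (auto simp: monomial_pos)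
    next
      fix x assume "x \<in> {x \<in> S. monomial x e = v}"
      then show "ln (monomial x n) \<in> ?Z"
        using sum_I[of x "ln (monomial x n)"] by (simp add: S monomial_pos)
    next
      fix s assume s: "s \<in> ?Z"
      obtain x where x: "x \<in> positive_orthant" "monomial x e = v" "monomial x n = exp s"
        by (rule monomials_surj[OF indep v(1), of "exp s"]) simp
      then have "x \<in> {x \<in> S. monomial x e = v}"
        using s v(2) sum_I[OF x] mono_f[OF x(1)] by (simp add: S)
      then show "\<exists>x\<in>{x \<in> S. monomial x e = v}. s = ln (monomial x n)" using x by force
    qed
    from bij_betw_same_card[OF this] bij_betw_finite[OF this] \<open>finite S\<close>
    have "card {x \<in> S. monomial x e = v} = card ?Z" "finite ?Z" by simp_all
    then show ?thesis
      using card_zeros_exp_sum[OF assms(1), of a "\<lambda>i. snd (g i)" 1] assms(1,2) by (simp add: card_gt_0_iff)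
  qed
  have "S = (\<Union>v\<in>V. {x \<in> S. monomial x e = v})" by (auto simp: V_def)
  then have "card S \<le> (\<Sum>v\<in>V. card {x \<in> S. monomial x e = v})"
    using card_UN_le[OF finV] by metis
  also have "\<dots> \<le> card V * card I" using sum_bounded_above[of V _ "card I"] fibre by simp
  also have "\<dots> \<le> 2 * card I" using cardV by (rule mult_le_mono1)
  finally show ?thesis .
qed

text \<open>With \<open>n = t - 1\<close>, the cost accumulated by the Wronskian steps is the cubic polynomial in \<open>t\<close>.\<close>

lemma wronskian_bound_closed_form:
  assumes "n \<ge> 1"
  shows "real (Suc ((\<Sum>j=1..<n. Suc (j * j)) + Suc n * n div 2)) =
    1/3 * real (Suc n) ^ 3 - real (Suc n) ^ 2 + 8/3 * real (Suc n) - 2"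
proof -
  have "real (\<Sum>j=1..<n. Suc (j * j)) = real (n - 1) + (real n - 1) * real n * (2 * real n - 1) / 6"
    using assms by (induction n rule: dec_induct) (simp_all add: field_simps)
  moreover have "real (Suc n * n div 2) = real (Suc n * n) / 2"
    by (subst real_of_nat_div) auto
  ultimately show ?thesis
    using assms by (simp add: of_nat_diff field_simps power3_eq_cube power2_eq_square)
qed

theorem theorem10:
  fixes t :: nat
    and bbar1 bbar2 :: "real ^ 2" and cbar1 cbar2 :: real
    and b :: "nat \<Rightarrow> real ^ 2" and c \<epsilon> :: "nat \<Rightarrow> real"
    and S :: "(real ^ 2) set"
  assumes t: "t \<ge> 3"
    and bbar_nz: "bbar1 \<noteq> 0" "bbar2 \<noteq> 0"
    and b_nz: "\<forall>i\<in>{1..t-1}. b i \<noteq> 0"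
    and bbar_distinct: "bbar1 \<noteq> bbar2"
    and b_distinct: "\<forall>i\<in>{1..t-1}. \<forall>j\<in>{1..t-1}. i \<noteq> j \<longrightarrow> b i \<noteq> b j"
    and cbar_pos: "cbar1 > 0" "cbar2 > 0"
    and c_pos: "\<forall>i\<in>{1..t-1}. c i > 0"
    and signs: "\<forall>i\<in>{1..t-1}. \<epsilon> i \<in> {1, -1}"
    and rank_two: "dim ({bbar1, bbar2} \<union> b ` {1..t-1}) = 2"
  defines "S \<equiv> {x \<in> positive_orthant.
        cbar1 * monomial x bbar1 + cbar2 * monomial x bbar2 - 1 = 0 \<and>
        (\<Sum>i=1..t-1. \<epsilon> i * c i * monomial x (b i)) - 1 = 0}"
  shows "infinite S \<or>
    real (card S) \<le> 1/3 * real t ^ 3 - real t ^ 2 + 8/3 * real t - 2"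
proof (cases "finite S")
  case fin: True
  let ?I = "{1..t-1}"
  let ?B = "Suc ((\<Sum>j=1..<card ?I. Suc (j * j)) + Suc (card ?I) * card ?I div 2)"
  have I: "finite ?I" "?I \<noteq> {}" "card ?I = t - 1" "Suc (t - 1) = t" using t by auto
  have S: "S = {x \<in> positive_orthant. cbar1 * monomial x bbar1 + cbar2 * monomial x bbar2 = 1 \<and>
        (\<Sum>i\<in>?I. (\<epsilon> i * c i) * monomial x (b i)) = 1}"
    by (simp add: S_def)
  have bound: "real ?B = 1/3 * real t ^ 3 - real t ^ 2 + 8/3 * real t - 2"
    using wronskian_bound_closed_form[of "t - 1"] t unfolding I by simp
  have "card S \<le> ?B"
  proof (cases "cross2 bbar1 bbar2 = 0")
    case True
    have "card S \<le> 2 * card ?I"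
      by (rule card_solutions_parallel[OF I(1,2) bbar_nz bbar_distinct True cbar_pos S fin])
    also have "\<dots> = Suc ((\<Sum>j=1..<card ?I. 2) + 1)" using t by (simp add: I)
    also have "\<dots> \<le> ?B"
    proof -
      have "(\<Sum>j=1..<card ?I. 2) \<le> (\<Sum>j=1..<card ?I. Suc (j * j))"
        by (intro sum_mono) (simp add: Suc_le_eq)
      moreover have "2 * 1 \<le> Suc (card ?I) * card ?I"
        using t by (intro mult_mono) (simp_all add: I)
      then have "1 \<le> Suc (card ?I) * card ?I div 2" by linarith
      ultimately show ?thesis by linarith
    qed
    finally show ?thesis .
  next
    case False
    have "inj_on b ?I" "0 \<notin> b ` ?I" using b_distinct b_nz by (auto simp: inj_on_def)
    from card_solutions_independent[OF I(1,2) this False cbar_pos S fin] show ?thesis .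
  qed
  then show ?thesis using bound by linarith
qed simp

end
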